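(* Let $1\le p,q\le\infty$ and $s\in\mathbb{R}$, and let $u(\omega)=\sum_{n\in\mathbb{Z}\setminus\{0\}}\frac{g_n(\omega)}{n}e^{int}$ be the mean-zero complex-valued periodic Brownian motion on $\mathbb{T}$, where $\{g_n\}_{n\neq0}$ are independent standard complex-valued Gaussian random variables. Then there exists $c>0$ (depending on the space under consideration, i.e. on $s,p,q$) such that, for all sufficiently large $K>0$, the following holds: (i) If $(s-1)q<-1$, then $Pr\big(\|u(\omega)\|_{M^{p,q}_s(\mathbb{T})}>K\big)<e^{-cK^2}$. (ii) If $(s-1)p<-1$, then $Pr\big(\|u(\omega)\|_{\widehat{b}^s_{p,q}(\mathbb{T})}>K\big)<e^{-cK^2}$. (iii) If $p<\infty$, $(s-1)p=-1$ and $q=\infty$, then $Pr\big(\|u(\omega)\|_{\widehat{b}^s_{p,\infty}(\mathbb{T})}>K\big)<e^{-cK^2}$. (When $q=\infty$ in (i), or $p=\infty$ in (ii), the condition is read as $s<1$.)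
   Context: $\mathbb{T}=\mathbb{R}/2\pi\mathbb{Z}$, $\langle n\rangle=(1+|n|^2)^{1/2}$, and $\widehat{u}(n)$, $n\in\mathbb{Z}$, denote Fourier coefficients; factors of $2\pi$ are ignored, so that $\widehat{u}(n)=g_n/n$ for $n\ne0$ and $\widehat u(0)=0$. "Standard complex-valued Gaussian" means that $\mathrm{Re}\,g_n$ and $\mathrm{Im}\,g_n$ are independent standard real-valued Gaussian random variables. $Pr$ is the underlying probability measure. Modulation space on the torus: $\|u\|_{M^{p,q}_s(\mathbb{T})}=\big\|\langle n\rangle^s\|\psi(D-n)u\|_{L^p_x(\mathbb{T})}\big\|_{\ell^q_n(\mathbb{Z})}$, where $\psi:\mathbb{Z}\to\mathbb{C}$ is finitely supported with $\sum_{n\in\mathbb{Z}}\psi(k-n)=1$ for all $k\in\mathbb{Z}$, and $\psi(D-n)u$ is the trigonometric polynomial with Fourier coefficients $\psi(k-n)\widehat{u}(k)$. For all $1\le p,q\le\infty$ this space coincides, with equivalent norms, with the Fourier-Lebesgue space $\mathcal{F}L^{s,q}(\mathbb{T})$ with norm $\|u\|_{\mathcal{F}L^{s,q}(\mathbb{T})}=\|\langle n\rangle^s\widehat{u}(n)\|_{\ell^q_n(\mathbb{Z})}$. Fourier-Besov space: let $\varphi_0,\varphi\in\mathcal{S}(\mathbb{R})$ with $\mathrm{supp}\,\varphi_0\subset\{|\xi|\le2\}$, $\mathrm{supp}\,\varphi\subset\{\frac12\le|\xi|\le2\}$, $\varphi_0(\xi)+\sum_{j\ge1}\varphi(2^{-j}\xi)\equiv1$,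 and $\varphi_j(\xi)=\varphi(2^{-j}\xi)$ for $j\ge1$. Then $\|u\|_{\widehat{b}^s_{p,q}(\mathbb{T})}=\big\|\,\|\langle n\rangle^s\varphi_j(n)\widehat{u}(n)\|_{\ell^p_n(\mathbb{Z})}\big\|_{\ell^q_j(\mathbb{Z}_{\ge0})}$. For mean-zero $u$ this is equivalent to $\big\|\,2^{js}\|\widehat{u}(n)\|_{\ell^p_{|n|\sim2^j}}\big\|_{\ell^q_j}$, where $|n|\sim2^j$ means $2^{j-1}<|n|\le2^j$. *)

theory Defs
  imports "HOL-Probability.Probability"
begin

section \<open>\<open>L\<^sup>p\<close> and \<open>\<ell>\<^sup>p\<close> norms with values in \<open>[0, \<infinity>]\<close>\<close>

definition ennreal_rpow :: "ennreal \<Rightarrow> real \<Rightarrow> ennreal" where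
  "ennreal_rpow x r = (if x = \<infinity> then \<infinity> else ennreal (enn2real x powr r))"
  \<comment> \<open>only used for exponents \<open>r > 0\<close>\<close>

definition Lp_norm :: "'a measure \<Rightarrow> ennreal \<Rightarrow> ('a \<Rightarrow> ennreal) \<Rightarrow> ennreal" where
  "Lp_norm M p f =
     (if p = \<infinity> then esssup M f
      else ennreal_rpow (\<integral>\<^sup>+ x. ennreal_rpow (f x) (enn2real p) \<partial>M) (1 / enn2real p))"
  \<comment> \<open>norm of a function with modulus \<open>f\<close>, for \<open>1 \<le> p \<le> \<infinity>\<close>\<close>

abbreviation lp_norm :: "ennreal \<Rightarrow> ('i \<Rightarrow> ennreal) \<Rightarrow> ennreal" where
  "lp_norm p a \<equiv> Lp_norm (count_space UNIV) p a"

definition torus :: "real measure" where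
  "torus = restrict_space lborel {0..<2 * pi}"
  \<comment> \<open>functions on \<open>\<real> / 2\<pi>\<int>\<close> are integrated over a fundamental domain, without normalisation\<close>


section \<open>Function spaces on the torus\<close>

text \<open>
  A periodic distribution \<open>u\<close> is identified with its sequence of Fourier coefficients
  \<open>a :: int \<Rightarrow> complex\<close>; both families of norms depend on \<open>u\<close> through \<open>a\<close> only.
\<close>

definition bracket :: "int \<Rightarrow> real" where
  "bracket n = (1 + \<bar>real_of_int n\<bar>\<^sup>2) powr (1 / 2)"

definition modulation_window :: "(int \<Rightarrow> complex) \<Rightarrow> bool" where
  "modulation_window \<psi> \<longleftrightarrow>
     finite {k. \<psi> k \<noteq> 0} \<and> (\<forall>k. (\<Sum>\<^sub>\<infinity>n. \<psi> (k - n)) = 1)"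

definition freq_piece :: "(int \<Rightarrow> complex) \<Rightarrow> int \<Rightarrow> (int \<Rightarrow> complex) \<Rightarrow> real \<Rightarrow> complex" where
  "freq_piece \<psi> n a x =
     (\<Sum>k | \<psi> (k - n) \<noteq> 0. \<psi> (k - n) * a k * exp (\<i> * of_int k * of_real x))"
  \<comment> \<open>the trigonometric polynomial \<open>\<psi>(D - n) u\<close>\<close>

definition modulation_norm ::
  "(int \<Rightarrow> complex) \<Rightarrow> real \<Rightarrow> ennreal \<Rightarrow> ennreal \<Rightarrow> (int \<Rightarrow> complex) \<Rightarrow> ennreal" where
  "modulation_norm \<psi> s p q a =
     lp_norm q (\<lambda>n. ennreal (bracket n powr s) *
                    Lp_norm torus p (\<lambda>x. ennreal (norm (freq_piece \<psi> n a x))))"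

definition iter_deriv :: "nat \<Rightarrow> (real \<Rightarrow> complex) \<Rightarrow> real \<Rightarrow> complex" where
  "iter_deriv k = ((\<lambda>f x. vector_derivative f (at x)) ^^ k)"

definition schwartz :: "(real \<Rightarrow> complex) \<Rightarrow> bool" where
  "schwartz f \<longleftrightarrow>
     (\<forall>k x. iter_deriv k f differentiable (at x)) \<and>
     (\<forall>k m. bounded (range (\<lambda>x. x ^ m *\<^sub>R iter_deriv k f x)))"

definition dyadic_partition :: "(real \<Rightarrow> complex) \<Rightarrow> (real \<Rightarrow> complex) \<Rightarrow> bool" where
  "dyadic_partition \<phi>0 \<phi> \<longleftrightarrow>
     schwartz \<phi>0 \<and> schwartz \<phi> \<and>
     closure {\<xi>. \<phi>0 \<xi> \<noteq> 0} \<subseteq> {\<xi>. \<bar>\<xi>\<bar> \<le> 2} \<and>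
     closure {\<xi>. \<phi> \<xi> \<noteq> 0} \<subseteq> {\<xi>. 1 / 2 \<le> \<bar>\<xi>\<bar> \<and> \<bar>\<xi>\<bar> \<le> 2} \<and>
     (\<forall>\<xi>. \<phi>0 \<xi> + (\<Sum>\<^sub>\<infinity>j\<in>{1::nat..}. \<phi> (\<xi> / 2 ^ j)) = 1)"

definition dyadic_cutoff :: "(real \<Rightarrow> complex) \<Rightarrow> (real \<Rightarrow> complex) \<Rightarrow> nat \<Rightarrow> real \<Rightarrow> complex" where
  "dyadic_cutoff \<phi>0 \<phi> j \<xi> = (if j = 0 then \<phi>0 \<xi> else \<phi> (\<xi> / 2 ^ j))"

definition fourier_besov_norm ::
  "(real \<Rightarrow> complex) \<Rightarrow> (real \<Rightarrow> complex) \<Rightarrow> real \<Rightarrow> ennreal \<Rightarrow> ennreal \<Rightarrow> (int \<Rightarrow> complex) \<Rightarrow> ennreal" where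
  "fourier_besov_norm \<phi>0 \<phi> s p q a =
     lp_norm q (\<lambda>j. lp_norm p (\<lambda>n.
       ennreal (norm (bracket n powr s *\<^sub>R (dyadic_cutoff \<phi>0 \<phi> j (of_int n) * a n)))))"


section \<open>Mean-zero complex-valued periodic Brownian motion\<close>

text \<open>Real and imaginary part each have variance 1, so \<open>g\<close> itself has variance 2.\<close>

definition (in prob_space) std_complex_gaussian :: "('a \<Rightarrow> complex) \<Rightarrow> bool" where
  "std_complex_gaussian X \<longleftrightarrow>
     distributed M lborel (\<lambda>\<omega>. Re (X \<omega>)) (\<lambda>x. ennreal (std_normal_density x)) \<and>
     distributed M lborel (\<lambda>\<omega>. Im (X \<omega>)) (\<lambda>x. ennreal (std_normal_density x)) \<and>
     indep_var borel (\<lambda>\<omega>. Re (X \<omega>)) borel (\<lambda>\<omega>. Im (X \<omega>))"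

definition brownian_coeffs :: "(int \<Rightarrow> 'a \<Rightarrow> complex) \<Rightarrow> 'a \<Rightarrow> int \<Rightarrow> complex" where
  "brownian_coeffs g \<omega> n = (if n = 0 then 0 else g n \<omega> / of_int n)"
  \<comment> \<open>Fourier coefficients of \<open>u(\<omega>) = \<Sum>\<^bsub>n \<noteq> 0\<^esub> g\<^sub>n(\<omega>) / n e\<^sup>i\<^sup>n\<^sup>t\<close>; \<open>g 0\<close> is irrelevant\<close>

end

theory Submission
  imports Defs
begin

text \<open>
  In the subcritical cases the norm is controlled pathwise by the growth of the coefficients. A
  complex Gaussian \<open>g\<close> satisfies \<open>Pr(|g|\<^sup>2 \<ge> t) \<le> 3 exp (- t / 8)\<close>, so the threshold
  \<open>K\<^sup>2 + 16 ln \<langle>n\<rangle>\<close> is exceeded at frequency \<open>n\<close> with probability at most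
  \<open>3 \<langle>n\<rangle>\<^sup>-\<^sup>2 exp (- K\<^sup>2 / 8)\<close>, and a union bound over \<open>n\<close> costs only a constant
  (\<open>gaussian_family_growth\<close>). Off this exceptional event a logarithm is absorbed by an arbitrarily
  small power and the \<open>n\<close>-th Fourier coefficient is at most
  \<open>C K \<langle>n\<rangle>\<^bsup>\<epsilon>-1\<^esup>\<close>. Since the conditions on \<open>s\<close> are strict, there is room
  for such an \<open>\<epsilon>\<close>, and then both norms of a sequence with this growth are at most a constant times
  \<open>K\<close> (\<open>modulation_norm_le\<close>, \<open>fourier_besov_norm_le\<close>). A bound of the form
  \<open>Pr(norm > C K) \<le> A exp (- c K\<^sup>2)\<close> gives the claim after rescaling \<open>K\<close> and halving the rate, which
  absorbs \<open>A\<close> for large \<open>K\<close>.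

  At the critical exponent there is no room for \<open>\<epsilon>\<close>. Here \<open>\<langle>n\<rangle>\<^bsup>(s-1)p\<^esup> = \<langle>n\<rangle>\<^sup>-\<^sup>1 \<sim> 2\<^sup>-\<^sup>j\<close> on
  the \<open>j\<close>-th dyadic block, so that the norm is at most a multiple of the supremum over \<open>j\<close> of
  \<open>(2\<^sup>-\<^sup>j \<Sum> |g n|\<^sup>p)\<^bsup>1/p\<^esup>\<close>, the sum ranging over the frequencies up to the block: a supremum of
  averages of independent variables. Two bounds for the probability that the \<open>j\<close>-th average exceeds a multiple of \<open>K\<^sup>p\<close>
  are combined. The union bound over these frequencies gives \<open>2\<^sup>j exp (- K\<^sup>2 / 8)\<close>, which is good for low
  frequencies; Chebyshev's inequality, with a variance that independence makes additive, gives
  \<open>2\<^sup>-\<^sup>j\<close>, which is good for high ones. The geometric mean with weights \<open>1/3\<close> and \<open>2/3\<close> is a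
  multiple of \<open>2\<^bsup>-j/3\<^esup> exp (- K\<^sup>2 / 24)\<close>, summable in \<open>j\<close> and Gaussian in \<open>K\<close>
  (\<open>dyadic_average_tail\<close>).
\<close>

section \<open>\<open>L\<^sup>p\<close> norms with values in \<open>[0, \<infinity>]\<close>\<close>

lemma ennreal_rpow_mono: "0 \<le> r \<Longrightarrow> x \<le> y \<Longrightarrow> ennreal_rpow x r \<le> ennreal_rpow y r"
  by (auto simp: ennreal_rpow_def top_unique less_top[symmetric]
        intro!: ennreal_leI powr_mono2 enn2real_mono)

lemma ennreal_rpow_ennreal: "0 \<le> x \<Longrightarrow> ennreal_rpow (ennreal x) r = ennreal (x powr r)"
  by (simp add: ennreal_rpow_def)

lemma ennreal_rpow_cmult:
  assumes "0 < c"
  shows "ennreal_rpow (ennreal c * x) r = ennreal (c powr r) * ennreal_rpow x r"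
proof (cases x)
  case (real y)
  then have "ennreal_rpow (ennreal c * x) r = ennreal ((c * y) powr r)"
    using assms by (simp add: ennreal_rpow_ennreal flip: ennreal_mult)
  then show ?thesis
    using real assms by (simp add: ennreal_rpow_ennreal powr_mult ennreal_mult)
next
  case top
  then show ?thesis using assms by (simp add: ennreal_rpow_def ennreal_mult_top)
qed

lemma ennreal_rpow_less_top: "x < top \<Longrightarrow> ennreal_rpow x r < top"
  by (auto simp: ennreal_rpow_def)

lemma borel_measurable_ennreal_rpow [measurable]:
  assumes [measurable]: "f \<in> borel_measurable M"
  shows "(\<lambda>x. ennreal_rpow (f x) r) \<in> borel_measurable M"
  unfolding ennreal_rpow_def by measurable

lemma enn2real_ge_1: "1 \<le> p \<Longrightarrow> p \<noteq> \<infinity> \<Longrightarrow> 1 \<le> enn2real p"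
  by (metis enn2real_1 enn2real_mono infinity_ennreal_def less_top)

text \<open>
  Every norm estimate below is a pointwise domination by a multiple of a fixed function of finite
  norm; this comparison turns it into an estimate that is linear in the multiple, uniformly in
  \<open>p \<in> [1, \<infinity>]\<close>.
\<close>

lemma Lp_norm_le_cmult:
  assumes p: "1 \<le> p" and c: "0 < c"
    and [measurable]: "f \<in> borel_measurable M" "g \<in> borel_measurable M"
    and le: "\<And>x. x \<in> space M \<Longrightarrow> f x \<le> ennreal c * g x"
  shows "Lp_norm M p f \<le> ennreal c * Lp_norm M p g"
proof (cases "p = \<infinity>")
  case True
  have "esssup M f \<le> ennreal c * esssup M g"
  proof (rule esssup_I)
    show "AE x in M. f x \<le> ennreal c * esssup M g"
      using esssup_AE[of g M] AE_space
      by eventually_elim (meson le mult_left_mono order_trans zero_le)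
  qed simp
  then show ?thesis using True by (simp add: Lp_norm_def)
next
  case False
  define r where "r = enn2real p"
  have r: "1 \<le> r" unfolding r_def using p False by (rule enn2real_ge_1)
  have "(\<integral>\<^sup>+x. ennreal_rpow (f x) r \<partial>M) \<le> (\<integral>\<^sup>+x. ennreal (c powr r) * ennreal_rpow (g x) r \<partial>M)"
    using r le by (intro nn_integral_mono)
      (auto simp flip: ennreal_rpow_cmult[OF c] intro!: ennreal_rpow_mono)
  also have "\<dots> = ennreal (c powr r) * (\<integral>\<^sup>+x. ennreal_rpow (g x) r \<partial>M)"
    by (simp add: nn_integral_cmult)
  finally have "ennreal_rpow (\<integral>\<^sup>+x. ennreal_rpow (f x) r \<partial>M) (1 / r)
      \<le> ennreal_rpow (ennreal (c powr r) * (\<integral>\<^sup>+x. ennreal_rpow (g x) r \<partial>M)) (1 / r)"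
    using r by (intro ennreal_rpow_mono) auto
  also have "\<dots> = ennreal c * ennreal_rpow (\<integral>\<^sup>+x. ennreal_rpow (g x) r \<partial>M) (1 / r)"
    using c r by (subst ennreal_rpow_cmult) (auto simp: powr_powr)
  finally show ?thesis using False by (simp add: Lp_norm_def r_def)
qed

lemma Lp_norm_le_cmult_finite:
  assumes "1 \<le> p" and "0 < c"
    and "f \<in> borel_measurable M" "g \<in> borel_measurable M"
    and "\<And>x. x \<in> space M \<Longrightarrow> f x \<le> ennreal c * g x"
    and "Lp_norm M p g < \<infinity>"
  shows "Lp_norm M p f \<le> ennreal (c * enn2real (Lp_norm M p g))"
  using Lp_norm_le_cmult[OF assms(1-5)] assms(2,6)
  by (simp add: ennreal_mult)

lemma Lp_norm_one_finite:
  assumes "finite_measure M" and p: "1 \<le> p"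
  shows "Lp_norm M p (\<lambda>_. 1) < \<infinity>"
proof -
  interpret finite_measure M by fact
  have "esssup M (\<lambda>_. 1::ennreal) \<le> 1" by (rule esssup_I) auto
  also have "(1::ennreal) < \<infinity>" by simp
  finally have "esssup M (\<lambda>_. 1::ennreal) < \<infinity>" .
  moreover have "(\<integral>\<^sup>+ x. ennreal_rpow 1 (enn2real p) \<partial>M) < \<infinity>"
    by (simp add: ennreal_rpow_def less_top[symmetric])
  ultimately show ?thesis by (auto simp: Lp_norm_def intro!: ennreal_rpow_less_top)
qed

section \<open>The Japanese bracket\<close>

lemma bracket_ge_1: "1 \<le> bracket n"
  unfolding bracket_def by (simp add: ge_one_powr_ge_zero)

lemma bracket_pos [simp]: "0 < bracket n"
  using bracket_ge_1[of n] by linarith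

lemma bracket_neq_0 [simp]: "bracket n \<noteq> 0"
  using bracket_pos[of n] by linarith

lemma abs_bracket [simp]: "\<bar>bracket n\<bar> = bracket n"
  using bracket_pos[of n] by linarith

lemma bracket_power2: "(bracket n)\<^sup>2 = 1 + (real_of_int n)\<^sup>2"
  unfolding bracket_def by (simp add: powr_half_sqrt)

lemma abs_le_bracket: "\<bar>real_of_int n\<bar> \<le> bracket n"
  by (rule power2_le_imp_le) (auto simp: bracket_power2 less_imp_le)

lemma bracket_le_sqrt2_abs: "n \<noteq> 0 \<Longrightarrow> bracket n \<le> sqrt 2 * \<bar>real_of_int n\<bar>"
proof (rule power2_le_imp_le)
  assume "n \<noteq> 0"
  then have "1 \<le> \<bar>real_of_int n\<bar>" by linarith
  then have "1 \<le> (real_of_int n)\<^sup>2" by (metis one_le_power power2_abs)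
  then show "(bracket n)\<^sup>2 \<le> (sqrt 2 * \<bar>real_of_int n\<bar>)\<^sup>2"
    by (simp add: bracket_power2 power_mult_distrib)
qed simp

lemma bracket_minus: "bracket (- n) = bracket n"
  by (simp add: bracket_def)

text \<open>
  Peetre's inequality, from \<open>(x + y)\<^sup>2 \<le> 2 x\<^sup>2 + 2 y\<^sup>2\<close>.
\<close>

lemma bracket_add_le: "bracket (m + n) \<le> sqrt 2 * bracket m * bracket n"
proof (rule power2_le_imp_le)
  define x y where "x = real_of_int m" and "y = real_of_int n"
  have "(x + y)\<^sup>2 \<le> 2 * x\<^sup>2 + 2 * y\<^sup>2"
    using zero_le_power2[of "x - y"] by (simp add: power2_eq_square algebra_simps)
  moreover have "0 \<le> x\<^sup>2 * y\<^sup>2" by simp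
  moreover have "2 * (1 + x\<^sup>2) * (1 + y\<^sup>2) = 2 + 2 * x\<^sup>2 + 2 * y\<^sup>2 + 2 * (x\<^sup>2 * y\<^sup>2)"
    by (simp add: algebra_simps)
  ultimately have "1 + (x + y)\<^sup>2 \<le> 2 * (1 + x\<^sup>2) * (1 + y\<^sup>2)"
    by linarith
  then show "(bracket (m + n))\<^sup>2 \<le> (sqrt 2 * bracket m * bracket n)\<^sup>2"
    by (simp add: power_mult_distrib bracket_power2 x_def y_def)
qed (simp add: less_imp_le)

text \<open>
  The integers are covered by two copies of the natural numbers, which share only \<open>0\<close>; counting
  \<open>0\<close> twice is harmless for an upper bound.
\<close>

lemma nn_integral_count_space_int_even:
  fixes f :: "int \<Rightarrow> ennreal"
  assumes "\<And>n. f (- n) = f n"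
  shows "(\<integral>\<^sup>+n. f n \<partial>count_space UNIV) \<le> 2 * (\<Sum>k. f (int k))"
proof -
  have "(\<integral>\<^sup>+n. f n \<partial>count_space UNIV)
      \<le> (\<integral>\<^sup>+n. f n * indicator (range int) n + f n * indicator (uminus ` range int) n \<partial>count_space UNIV)"
  proof (intro nn_integral_mono)
    fix n :: int
    have "n \<in> range int \<or> n \<in> uminus ` range int"
      by (cases n rule: int_cases2) (auto simp: image_image)
    then show "f n \<le> f n * indicator (range int) n + f n * indicator (uminus ` range int) n"
      by (auto split: split_indicator)
  qed
  also have "\<dots> = (\<integral>\<^sup>+n. f n \<partial>count_space (range int)) + (\<integral>\<^sup>+n. f n \<partial>count_space (uminus ` range int))"
    by (subst nn_integral_add) (auto simp: nn_integral_count_space_indicator)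
  also have "(\<integral>\<^sup>+n. f n \<partial>count_space (range int)) = (\<integral>\<^sup>+k. f (int k) \<partial>count_space UNIV)"
    by (intro nn_integral_bij_count_space[symmetric]) (auto simp: bij_betw_def)
  also have "(\<integral>\<^sup>+n. f n \<partial>count_space (uminus ` range int)) = (\<integral>\<^sup>+k. f (- int k) \<partial>count_space UNIV)"
    by (intro nn_integral_bij_count_space[symmetric, where g = "\<lambda>k. - int k"])
       (auto simp: bij_betw_def inj_def image_image)
  finally show ?thesis
    by (simp add: assms nn_integral_count_space_nat mult_2)
qed

lemma nn_integral_bracket_powr_finite:
  assumes "\<sigma> < -1"
  shows "(\<integral>\<^sup>+n. ennreal (bracket n powr \<sigma>) \<partial>count_space UNIV) < \<infinity>"
proof -
  have "summable (\<lambda>k. bracket (int k) powr \<sigma>)"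
  proof (rule summable_comparison_test_ev)
    show "summable (\<lambda>k. of_nat k powr \<sigma> :: real)"
      using assms by (simp add: summable_real_powr_iff)
    show "\<forall>\<^sub>F k in sequentially. norm (bracket (int k) powr \<sigma>) \<le> of_nat k powr \<sigma>"
      using eventually_gt_at_top[of 0]
    proof eventually_elim
      case (elim k)
      then show ?case using abs_le_bracket[of "int k"] assms
        by (auto intro!: powr_mono2')
    qed
  qed
  then have "(\<Sum>k. ennreal (bracket (int k) powr \<sigma>)) < \<infinity>"
    by (simp add: ennreal_suminf_neq_top less_top[symmetric])
  then have "2 * (\<Sum>k. ennreal (bracket (int k) powr \<sigma>)) < \<infinity>"
    by (simp add: ennreal_mult_less_top)
  with nn_integral_count_space_int_even[of "\<lambda>n. ennreal (bracket n powr \<sigma>)", unfolded bracket_minus, OF refl]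
  show ?thesis by (rule order_le_less_trans)
qed

lemma lp_norm_bracket_finite:
  assumes "1 \<le> q" and "if q = \<infinity> then \<sigma> \<le> 0 else \<sigma> * enn2real q < -1"
  shows "lp_norm q (\<lambda>n. ennreal (bracket n powr \<sigma>)) < \<infinity>"
proof (cases "q = \<infinity>")
  case True
  have "bracket n powr \<sigma> \<le> 1" for n
    using assms True bracket_ge_1[of n] powr_mono[of \<sigma> 0 "bracket n"] by simp
  then have "esssup (count_space UNIV) (\<lambda>n. ennreal (bracket n powr \<sigma>)) \<le> 1"
    by (intro esssup_I) auto
  also have "(1::ennreal) < \<infinity>" by simp
  finally show ?thesis using True by (simp add: Lp_norm_def)
next
  case False
  then show ?thesis
    using nn_integral_bracket_powr_finite[of "\<sigma> * enn2real q"] assms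
    by (auto simp: Lp_norm_def ennreal_rpow_ennreal powr_powr intro!: ennreal_rpow_less_top)
qed

lemma lp_norm_geometric_finite:
  assumes q: "1 \<le> q" and b: "0 < b" "b < 1"
  shows "lp_norm q (\<lambda>j::nat. ennreal (b ^ j)) < \<infinity>"
proof (cases "q = \<infinity>")
  case True
  have "esssup (count_space UNIV) (\<lambda>j::nat. ennreal (b ^ j)) \<le> 1"
    using b by (intro esssup_I) (auto simp: power_le_one)
  also have "(1::ennreal) < \<infinity>" by simp
  finally show ?thesis using True by (simp add: Lp_norm_def)
next
  case False
  define r where "r = enn2real q"
  have r: "1 \<le> r" unfolding r_def using q False by (rule enn2real_ge_1)
  have *: "(b ^ j) powr r = (b powr r) ^ j" for j
  proof -
    have "(b ^ j) powr r = (b powr real j) powr r" using b by (simp add: powr_realpow)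
    also have "\<dots> = (b powr r) powr real j" by (simp add: powr_powr mult.commute)
    finally show ?thesis using b by (simp add: powr_realpow)
  qed
  have "b powr r < 1" using b r powr_less_mono2[of r b 1] by simp
  then have "summable (\<lambda>j. (b powr r) ^ j)" by (simp add: summable_geometric)
  then have "(\<Sum>j. ennreal ((b powr r) ^ j)) < \<infinity>"
    using b by (simp add: ennreal_suminf_neq_top less_top[symmetric])
  then show ?thesis using False b
    by (auto simp: Lp_norm_def ennreal_rpow_ennreal r_def[symmetric] * nn_integral_count_space_nat
        intro!: ennreal_rpow_less_top)
qed

section \<open>Modulation norms of sequences of polynomial growth\<close>

text \<open>
  A shift by a bounded frequency changes a power of the bracket only by a constant. Negative powers
  need the bracket at \<open>m + n\<close> bounded from below, which is Peetre's inequality for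
  \<open>n = (m + n) + (- m)\<close>.
\<close>

lemma bracket_shift_powr_le:
  assumes "-1 \<le> t" "t \<le> 0"
  shows "bracket (m + n) powr t \<le> sqrt 2 * bracket m * bracket n powr t"
proof -
  define c where "c = sqrt 2 * bracket m"
  have c: "1 \<le> c" unfolding c_def using bracket_ge_1[of m] mult_mono[of 1 "sqrt 2" 1 "bracket m"] by simp
  have "bracket n \<le> sqrt 2 * bracket (m + n) * bracket (- m)"
    using bracket_add_le[of "m + n" "- m"] by simp
  then have "bracket n / c \<le> bracket (m + n)"
    using c by (simp add: c_def bracket_minus field_simps)
  then have "bracket (m + n) powr t \<le> (bracket n / c) powr t"
    using assms c by (intro powr_mono2') (auto intro: divide_pos_pos)
  also have "\<dots> = c powr (- t) * bracket n powr t"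
    using c by (simp add: powr_divide powr_minus divide_simps)
  also have "\<dots> \<le> c powr 1 * bracket n powr t"
    using assms c by (intro mult_right_mono powr_mono) auto
  finally show ?thesis using c by (simp add: c_def)
qed

lemma freq_piece_eq_sum_window:
  "freq_piece \<psi> n a x =
     (\<Sum>m | \<psi> m \<noteq> 0. \<psi> m * a (m + n) * exp (\<i> * of_int (m + n) * of_real x))"
proof -
  have "{k. \<psi> (k - n) \<noteq> 0} = (\<lambda>m. m + n) ` {m. \<psi> m \<noteq> 0}"
  proof (intro set_eqI iffI)
    fix k assume "k \<in> {k. \<psi> (k - n) \<noteq> 0}"
    then show "k \<in> (\<lambda>m. m + n) ` {m. \<psi> m \<noteq> 0}"
      by (intro image_eqI[of _ _ "k - n"]) auto
  qed auto
  then show ?thesis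
    unfolding freq_piece_def by (simp add: sum.reindex)
qed

lemma freq_piece_norm_le:
  assumes "0 \<le> B" and t: "-1 \<le> t" "t \<le> 0" and a: "\<And>n. norm (a n) \<le> B * bracket n powr t"
  shows "norm (freq_piece \<psi> n a x)
      \<le> B * (\<Sum>m | \<psi> m \<noteq> 0. norm (\<psi> m) * (sqrt 2 * bracket m)) * bracket n powr t"
proof -
  have "norm (freq_piece \<psi> n a x) \<le> (\<Sum>m | \<psi> m \<noteq> 0. norm (\<psi> m) * norm (a (m + n)))"
    unfolding freq_piece_eq_sum_window
    by (rule order_trans[OF norm_sum]) (simp add: norm_mult norm_exp_eq_Re)
  also have "\<dots> \<le> (\<Sum>m | \<psi> m \<noteq> 0. norm (\<psi> m) * (B * (sqrt 2 * bracket m * bracket n powr t)))"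
    using assms
    by (intro sum_mono mult_left_mono order_trans[OF a] bracket_shift_powr_le) auto
  also have "\<dots> = B * (\<Sum>m | \<psi> m \<noteq> 0. norm (\<psi> m) * (sqrt 2 * bracket m)) * bracket n powr t"
    by (simp add: sum_distrib_left sum_distrib_right mult_ac)
  finally show ?thesis .
qed

lemma finite_measure_torus: "finite_measure torus"
  unfolding torus_def
  by (intro finite_measureI) (simp add: emeasure_restrict_space space_restrict_space)

lemma borel_measurable_freq_piece [measurable]: "freq_piece \<psi> n a \<in> borel_measurable torus"
proof -
  have "continuous_on UNIV (freq_piece \<psi> n a)"
    unfolding freq_piece_def by (intro continuous_intros)
  then show ?thesis
    unfolding torus_def
    by (intro measurable_restrict_space1) (simp add: borel_measurable_continuous_onI)
qed

text \<open>
  For a window of finite support, the piece at frequency \<open>n\<close> involves only the coefficients at a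
  bounded distance from \<open>n\<close>, so it is bounded uniformly in \<open>x\<close> by a multiple of
  \<open>B \<langle>n\<rangle>\<^bsup>\<epsilon>-1\<^esup>\<close>; over an infinite support the sum is \<open>0\<close> by convention. On the torus, of finite measure, every \<open>L\<^sup>p\<close> norm then has the same bound. What is
  left is the \<open>\<ell>\<^sup>q\<close> norm of \<open>\<langle>n\<rangle>\<^bsup>s-1+\<epsilon>\<^esup>\<close>.
\<close>

lemma modulation_norm_le:
  assumes "1 \<le> p" "1 \<le> q" and \<epsilon>: "0 \<le> \<epsilon>" "\<epsilon> \<le> 1"
    and fin: "lp_norm q (\<lambda>n. ennreal (bracket n powr (s - 1 + \<epsilon>))) < \<infinity>"
  shows "\<exists>D>0. \<forall>a B. 0 < B \<longrightarrow> (\<forall>n. norm (a n) \<le> B * bracket n powr (\<epsilon> - 1))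
           \<longrightarrow> modulation_norm \<psi> s p q a \<le> ennreal (D * B)"
proof -
  \<comment> \<open>\<open>W\<close> exceeds the weighted mass of the window by 1, which makes it positive.\<close>
  define W where "W = 1 + (\<Sum>m | \<psi> m \<noteq> 0. norm (\<psi> m) * (sqrt 2 * bracket m))"
  define L where "L = enn2real (Lp_norm torus p (\<lambda>_. 1))"
  define N where "N = enn2real (lp_norm q (\<lambda>n. ennreal (bracket n powr (s - 1 + \<epsilon>))))"
  have W: "1 \<le> W" unfolding W_def by (simp add: sum_nonneg less_imp_le)
  have L: "0 \<le> L" and N: "0 \<le> N" unfolding L_def N_def by auto
  have "modulation_norm \<psi> s p q a \<le> ennreal (W * (L + 1) * (N + 1) * B)"
    if B: "0 < B" and a: "\<And>n. norm (a n) \<le> B * bracket n powr (\<epsilon> - 1)" for a B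
  proof -
    have "ennreal (bracket n powr s) * Lp_norm torus p (\<lambda>x. ennreal (norm (freq_piece \<psi> n a x)))
        \<le> ennreal (B * W * (L + 1)) * ennreal (bracket n powr (s - 1 + \<epsilon>))" for n
    proof -
      have "norm (freq_piece \<psi> n a x) \<le> B * W * bracket n powr (\<epsilon> - 1)" for x
      proof -
        have "norm (freq_piece \<psi> n a x) \<le> B * (W - 1) * bracket n powr (\<epsilon> - 1)"
          using freq_piece_norm_le[of B "\<epsilon> - 1" a \<psi> n x] B \<epsilon> a by (simp add: W_def)
        also have "\<dots> \<le> B * W * bracket n powr (\<epsilon> - 1)"
          using B by (intro mult_right_mono mult_left_mono) auto
        finally show ?thesis .
      qed
      then have "Lp_norm torus p (\<lambda>x. ennreal (norm (freq_piece \<psi> n a x)))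
          \<le> ennreal (B * W * bracket n powr (\<epsilon> - 1) * L)"
        unfolding L_def using B W assms(1) Lp_norm_one_finite[OF finite_measure_torus]
        by (intro Lp_norm_le_cmult_finite) (auto intro!: ennreal_leI mult_pos_pos)
      also have "\<dots> \<le> ennreal (B * W * bracket n powr (\<epsilon> - 1) * (L + 1))"
        using B W by (intro ennreal_leI mult_left_mono) auto
      finally have "ennreal (bracket n powr s) * Lp_norm torus p (\<lambda>x. ennreal (norm (freq_piece \<psi> n a x)))
          \<le> ennreal (bracket n powr s) * ennreal (B * W * bracket n powr (\<epsilon> - 1) * (L + 1))"
        by (rule mult_left_mono) simp
      also have "\<dots> = ennreal (B * W * (L + 1) * (bracket n powr s * bracket n powr (\<epsilon> - 1)))"
        using B W L by (simp add: mult_ac flip: ennreal_mult)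
      also have "bracket n powr s * bracket n powr (\<epsilon> - 1) = bracket n powr (s - 1 + \<epsilon>)"
        by (simp add: algebra_simps flip: powr_add)
      finally show ?thesis using B W L by (simp add: ennreal_mult)
    qed
    then have "modulation_norm \<psi> s p q a \<le> ennreal (B * W * (L + 1) * N)"
      unfolding modulation_norm_def N_def using B W L assms(2) fin
      by (intro Lp_norm_le_cmult_finite) auto
    also have "\<dots> \<le> ennreal (W * (L + 1) * (N + 1) * B)"
      using B W L by (intro ennreal_leI) (simp add: algebra_simps)
    finally show ?thesis .
  qed
  moreover have "0 < W * (L + 1) * (N + 1)" using W L N by simp
  ultimately show ?thesis by blast
qed

section \<open>Fourier-Besov norms\<close>

text \<open>
  A Schwartz function is bounded: this is the seminorm with no derivative and no weight.
\<close>

lemma dyadic_cutoff_bounded: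
  assumes "dyadic_partition \<phi>0 \<phi>"
  obtains B where "0 < B" "\<And>j \<xi>. norm (dyadic_cutoff \<phi>0 \<phi> j \<xi>) \<le> B"
proof -
  have "bounded (range f)" if "schwartz f" for f
  proof -
    have "bounded (range (\<lambda>x. x ^ 0 *\<^sub>R iter_deriv 0 f x))"
      using that unfolding schwartz_def by blast
    then show ?thesis by (simp add: iter_deriv_def)
  qed
  then have "bounded (range \<phi>0 \<union> range \<phi>)"
    using assms by (simp add: dyadic_partition_def)
  then obtain B where "0 < B" "\<And>z. z \<in> range \<phi>0 \<union> range \<phi> \<Longrightarrow> norm z \<le> B"
    by (auto simp: bounded_pos)
  then show thesis by (intro that[of B]) (auto simp: dyadic_cutoff_def)
qed

lemma dyadic_cutoff_support:
  assumes "dyadic_partition \<phi>0 \<phi>" and nz: "dyadic_cutoff \<phi>0 \<phi> j \<xi> \<noteq> 0"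
  shows "\<bar>\<xi>\<bar> \<le> 2 * 2 ^ j" "j \<noteq> 0 \<Longrightarrow> 2 ^ j / 2 \<le> \<bar>\<xi>\<bar>"
proof -
  have 0: "\<bar>x\<bar> \<le> 2" if "\<phi>0 x \<noteq> 0" for x
    using that assms(1) closure_subset[of "{\<xi>. \<phi>0 \<xi> \<noteq> 0}"] unfolding dyadic_partition_def by blast
  have 1: "1 / 2 \<le> \<bar>x\<bar> \<and> \<bar>x\<bar> \<le> 2" if "\<phi> x \<noteq> 0" for x
    using that assms(1) closure_subset[of "{\<xi>. \<phi> \<xi> \<noteq> 0}"] unfolding dyadic_partition_def by blast
  show "\<bar>\<xi>\<bar> \<le> 2 * 2 ^ j"
    using nz 0[of \<xi>] 1[of "\<xi> / 2 ^ j"]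
    by (auto simp: dyadic_cutoff_def abs_divide divide_simps split: if_splits)
  show "2 ^ j / 2 \<le> \<bar>\<xi>\<bar>" if "j \<noteq> 0"
    using that nz 1[of "\<xi> / 2 ^ j"]
    by (auto simp: dyadic_cutoff_def abs_divide divide_simps split: if_splits)
qed

text \<open>
  For \<open>j = 0\<close> the cutoff does not vanish near \<open>0\<close>, but the bracket is at least \<open>1\<close> everywhere, so the
  lower bound holds for all \<open>j\<close> alike.
\<close>

lemma dyadic_cutoff_bracket_ge:
  assumes "dyadic_partition \<phi>0 \<phi>" "dyadic_cutoff \<phi>0 \<phi> j (of_int n) \<noteq> 0"
  shows "2 ^ j / 2 \<le> bracket n"
  using dyadic_cutoff_support(2)[OF assms] abs_le_bracket[of n] bracket_ge_1[of n]
  by (cases "j = 0") auto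

text \<open>
  The finiteness assumption spends \<open>2 \<epsilon>\<close> while the growth of the coefficients uses only one \<open>\<epsilon>\<close>.
  On the \<open>j\<close>-th block the spare factor \<open>\<langle>n\<rangle>\<^bsup>-\<epsilon>\<^esup>\<close> is at most a multiple of \<open>2\<^bsup>-j\<epsilon>\<^esup>\<close>, and this geometric decay
  gives the outer \<open>\<ell>\<^sup>q\<close> norm for every \<open>q\<close>.
\<close>

lemma fourier_besov_norm_le:
  assumes p: "1 \<le> p" and q: "1 \<le> q" and \<epsilon>: "0 < \<epsilon>"
    and part: "dyadic_partition \<phi>0 \<phi>"
    and fin: "lp_norm p (\<lambda>n. ennreal (bracket n powr (s - 1 + 2 * \<epsilon>))) < \<infinity>"
  shows "\<exists>D>0. \<forall>a B. 0 < B \<longrightarrow> (\<forall>n. norm (a n) \<le> B * bracket n powr (\<epsilon> - 1))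
           \<longrightarrow> fourier_besov_norm \<phi>0 \<phi> s p q a \<le> ennreal (D * B)"
proof -
  obtain B0 where B0: "0 < B0" "\<And>j \<xi>. norm (dyadic_cutoff \<phi>0 \<phi> j \<xi>) \<le> B0"
    using dyadic_cutoff_bounded[OF part] by blast
  define \<beta> where "\<beta> = 2 powr (- \<epsilon>)"
  define N where "N = enn2real (lp_norm p (\<lambda>n. ennreal (bracket n powr (s - 1 + 2 * \<epsilon>))))"
  define G where "G = enn2real (lp_norm q (\<lambda>j::nat. ennreal (\<beta> ^ j)))"
  have \<beta>: "0 < \<beta>" "\<beta> < 1" unfolding \<beta>_def using \<epsilon> powr_less_mono[of "- \<epsilon>" 0 2] by auto
  have NG: "0 \<le> N" "0 \<le> G" unfolding N_def G_def by auto
  have "fourier_besov_norm \<phi>0 \<phi> s p q a \<le> ennreal (B0 * 2 powr \<epsilon> * (N + 1) * (G + 1) * B)"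
    if B: "0 < B" and a: "\<And>n. norm (a n) \<le> B * bracket n powr (\<epsilon> - 1)" for a B
  proof -
    have "lp_norm p (\<lambda>n. ennreal (norm (bracket n powr s *\<^sub>R (dyadic_cutoff \<phi>0 \<phi> j (of_int n) * a n))))
        \<le> ennreal (B0 * B * 2 powr \<epsilon> * (N + 1)) * ennreal (\<beta> ^ j)" for j
    proof -
      have "norm (bracket n powr s *\<^sub>R (dyadic_cutoff \<phi>0 \<phi> j (of_int n) * a n))
          \<le> B0 * B * 2 powr \<epsilon> * \<beta> ^ j * bracket n powr (s - 1 + 2 * \<epsilon>)" for n
      proof (cases "dyadic_cutoff \<phi>0 \<phi> j (of_int n) = 0")
        case True
        then show ?thesis using B B0(1) \<beta> by simp
      next
        case False
        have "bracket n powr (- \<epsilon>) \<le> (2 ^ j / 2) powr (- \<epsilon>)"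
          using dyadic_cutoff_bracket_ge[OF part False] \<epsilon> by (intro powr_mono2') auto
        also have "\<dots> = 2 powr \<epsilon> * \<beta> ^ j"
        proof -
          have "(2 ^ j / 2) powr (- \<epsilon>) = (2 powr (real j - 1)) powr (- \<epsilon>)"
            by (simp add: powr_diff powr_realpow)
          also have "\<dots> = 2 powr \<epsilon> * \<beta> powr real j"
            unfolding \<beta>_def by (simp add: powr_powr algebra_simps flip: powr_add)
          finally show ?thesis using \<beta> by (simp add: powr_realpow)
        qed
        finally have decay: "bracket n powr (- \<epsilon>) \<le> 2 powr \<epsilon> * \<beta> ^ j" .
        have "norm (bracket n powr s *\<^sub>R (dyadic_cutoff \<phi>0 \<phi> j (of_int n) * a n))
            \<le> bracket n powr s * (B0 * (B * bracket n powr (\<epsilon> - 1)))"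
          using B0 a[of n] by (auto simp: norm_mult intro!: mult_left_mono mult_mono)
        also have "\<dots> = B0 * B * (bracket n powr (- \<epsilon>) * bracket n powr (s - 1 + 2 * \<epsilon>))"
          by (simp add: algebra_simps flip: powr_add)
        also have "\<dots> \<le> B0 * B * ((2 powr \<epsilon> * \<beta> ^ j) * bracket n powr (s - 1 + 2 * \<epsilon>))"
          using decay B B0(1) by (intro mult_left_mono mult_right_mono) auto
        finally show ?thesis by (simp add: mult_ac)
      qed
      then have "lp_norm p (\<lambda>n. ennreal (norm (bracket n powr s *\<^sub>R (dyadic_cutoff \<phi>0 \<phi> j (of_int n) * a n))))
          \<le> ennreal (B0 * B * 2 powr \<epsilon> * \<beta> ^ j * N)"
        unfolding N_def using B B0(1) \<beta> p fin
        by (intro Lp_norm_le_cmult_finite) (auto simp flip: ennreal_mult intro!: ennreal_leI)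
      also have "\<dots> \<le> ennreal (B0 * B * 2 powr \<epsilon> * (N + 1) * \<beta> ^ j)"
        using B B0(1) \<beta> by (intro ennreal_leI) (simp add: algebra_simps)
      finally show ?thesis using B B0(1) \<beta> NG by (simp add: ennreal_mult)
    qed
    then have "fourier_besov_norm \<phi>0 \<phi> s p q a \<le> ennreal (B0 * B * 2 powr \<epsilon> * (N + 1) * G)"
      unfolding fourier_besov_norm_def G_def
      using B B0(1) NG q lp_norm_geometric_finite[OF q \<beta>]
      by (intro Lp_norm_le_cmult_finite) auto
    also have "\<dots> \<le> ennreal (B0 * 2 powr \<epsilon> * (N + 1) * (G + 1) * B)"
      using B B0(1) NG by (intro ennreal_leI) (simp add: algebra_simps)
    finally show ?thesis .
  qed
  moreover have "0 < B0 * 2 powr \<epsilon> * (N + 1) * (G + 1)" using B0(1) NG by simp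
  ultimately show ?thesis by blast
qed

text \<open>
  The bound is \<open>2\<^bsup>j+1\<^esup>\<close>, the outer edge of the \<open>j\<close>-th dyadic cutoff. Keeping all smaller nonzero
  frequencies costs only a constant, as their number is still of order \<open>2\<^sup>j\<close>.
\<close>

definition low_freqs :: "nat \<Rightarrow> int set" where
  "low_freqs j = {n. n \<noteq> 0 \<and> \<bar>n\<bar> \<le> 2 * 2 ^ j}"

lemma low_freqs_eq: "low_freqs j = {- (2 * 2 ^ j)..2 * 2 ^ j} - {0}"
  by (auto simp: low_freqs_def)

lemma finite_low_freqs [simp]: "finite (low_freqs j)"
  by (simp add: low_freqs_eq)

lemma card_low_freqs: "real (card (low_freqs j)) = 4 * 2 ^ j"
proof -
  have "card (low_freqs j) = card {- (2 * 2 ^ j)..2 * 2 ^ j :: int} - 1"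
    unfolding low_freqs_eq by (subst card_Diff_singleton) auto
  also have "\<dots> = nat (4 * 2 ^ j)" by simp
  finally have "card (low_freqs j) = 4 * 2 ^ j" by (simp add: nat_mult_distrib nat_power_eq)
  then show ?thesis by simp
qed

text \<open>
  At the critical exponent the \<open>p\<close>-th power of the weight \<open>\<langle>n\<rangle>\<^bsup>s-1\<^esup>\<close> is \<open>\<langle>n\<rangle>\<^sup>-\<^sup>1\<close>, at most
  \<open>2 / 2\<^sup>j\<close> on the \<open>j\<close>-th block. The inner norm is therefore controlled by the average of
  \<open>|n a(n)|\<^sup>p\<close>, and for Brownian motion \<open>n a(n)\<close> is the Gaussian itself.
\<close>

lemma fourier_besov_norm_critical_le:
  assumes p: "1 \<le> p" "p < \<infinity>" and part: "dyadic_partition \<phi>0 \<phi>"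
    and crit: "(s - 1) * enn2real p = -1"
  shows "\<exists>D>0. \<forall>a K. 0 < K \<longrightarrow> a 0 = 0 \<longrightarrow>
      (\<forall>j. (\<Sum>n\<in>low_freqs j. norm (of_int n * a n) powr enn2real p) \<le> 4 * 2 ^ j * K powr enn2real p)
      \<longrightarrow> fourier_besov_norm \<phi>0 \<phi> s p \<infinity> a \<le> ennreal (D * K)"
proof -
  define r where "r = enn2real p"
  have r: "1 \<le> r" unfolding r_def using p by (intro enn2real_ge_1) auto
  obtain B where B: "0 < B" "\<And>j \<xi>. norm (dyadic_cutoff \<phi>0 \<phi> j \<xi>) \<le> B"
    using dyadic_cutoff_bounded[OF part] by blast
  define c where "c = B * sqrt 2"
  have c: "0 < c" using B by (simp add: c_def)
  have "fourier_besov_norm \<phi>0 \<phi> s p \<infinity> a \<le> ennreal (c * 8 powr (1 / r) * K)"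
    if K: "0 < K" and a0: "a 0 = 0"
      and avg: "\<And>j. (\<Sum>n\<in>low_freqs j. norm (of_int n * a n) powr r) \<le> 4 * 2 ^ j * K powr r" for a K
  proof -
    define h where "h j n = c powr r * (2 / 2 ^ j) * norm (of_int n * a n) powr r" for j n
    have "lp_norm p (\<lambda>n. ennreal (norm (bracket n powr s *\<^sub>R (dyadic_cutoff \<phi>0 \<phi> j (of_int n) * a n))))
        \<le> ennreal (c * 8 powr (1 / r) * K)" for j
    proof -
      have pt: "norm (bracket n powr s *\<^sub>R (dyadic_cutoff \<phi>0 \<phi> j (of_int n) * a n)) powr r
          \<le> h j n * indicator (low_freqs j) n" for n
      proof (cases "dyadic_cutoff \<phi>0 \<phi> j (of_int n) = 0 \<or> n = 0")
        case True
        then show ?thesis using a0 c by (auto simp: h_def)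
      next
        case False
        have nJ: "n \<in> low_freqs j"
        proof -
          have "real_of_int \<bar>n\<bar> \<le> real_of_int (2 * 2 ^ j)"
            using False dyadic_cutoff_support(1)[OF part, of j "of_int n"] by simp
          then show ?thesis using False unfolding low_freqs_def of_int_le_iff by simp
        qed
        have n: "1 \<le> \<bar>real_of_int n\<bar>" using False by linarith
        have "norm (bracket n powr s *\<^sub>R (dyadic_cutoff \<phi>0 \<phi> j (of_int n) * a n))
            \<le> bracket n powr s * (B * norm (a n))"
          using B(2) by (auto simp: norm_mult intro!: mult_left_mono mult_right_mono)
        also have "\<dots> = bracket n powr (s - 1) * B * (bracket n * norm (a n))"
          by (simp add: powr_diff abs_of_pos)
        also have "\<dots> \<le> bracket n powr (s - 1) * B * (sqrt 2 * \<bar>real_of_int n\<bar> * norm (a n))"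
          using B(1) bracket_le_sqrt2_abs[of n] False by (intro mult_left_mono mult_right_mono) auto
        also have "\<dots> = c * bracket n powr (s - 1) * norm (of_int n * a n)"
          by (simp add: c_def norm_mult mult_ac)
        finally have "norm (bracket n powr s *\<^sub>R (dyadic_cutoff \<phi>0 \<phi> j (of_int n) * a n)) powr r
            \<le> (c * bracket n powr (s - 1) * norm (of_int n * a n)) powr r"
          using r by (intro powr_mono2) auto
        also have "\<dots> = c powr r * bracket n powr (-1) * norm (of_int n * a n) powr r"
          using c crit by (simp add: powr_mult powr_powr r_def)
        also have "\<dots> \<le> c powr r * (2 / 2 ^ j) * norm (of_int n * a n) powr r"
        proof (intro mult_left_mono mult_right_mono)
          show "bracket n powr (-1) \<le> 2 / 2 ^ j"
            using dyadic_cutoff_bracket_ge[OF part] False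
            by (simp add: powr_minus field_simps)
        qed auto
        finally show ?thesis using nJ by (simp add: h_def)
      qed
      have "(\<integral>\<^sup>+n. ennreal (norm (bracket n powr s *\<^sub>R (dyadic_cutoff \<phi>0 \<phi> j (of_int n) * a n)) powr r)
          \<partial>count_space UNIV) \<le> (\<integral>\<^sup>+n. ennreal (h j n) * indicator (low_freqs j) n \<partial>count_space UNIV)"
        by (intro nn_integral_mono order_trans[OF ennreal_leI[OF pt]]) (simp split: split_indicator)
      also have "\<dots> = ennreal (\<Sum>n\<in>low_freqs j. h j n)"
        using c by (simp add: nn_integral_count_space_indicator[symmetric] nn_integral_count_space_finite h_def sum_ennreal)
      also have "\<dots> \<le> ennreal (c powr r * 8 * K powr r)"
      proof (rule ennreal_leI)
        have "(\<Sum>n\<in>low_freqs j. h j n)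
            = c powr r * (2 / 2 ^ j) * (\<Sum>n\<in>low_freqs j. norm (of_int n * a n) powr r)"
          by (simp add: h_def sum_distrib_left)
        also have "\<dots> \<le> c powr r * (2 / 2 ^ j) * (4 * 2 ^ j * K powr r)"
          by (intro mult_left_mono avg) auto
        finally show "(\<Sum>n\<in>low_freqs j. h j n) \<le> c powr r * 8 * K powr r" by simp
      qed
      finally have "ennreal_rpow (\<integral>\<^sup>+n. ennreal (norm (bracket n powr s *\<^sub>R (dyadic_cutoff \<phi>0 \<phi> j (of_int n) * a n)) powr r)
          \<partial>count_space UNIV) (1 / r) \<le> ennreal_rpow (ennreal (c powr r * 8 * K powr r)) (1 / r)"
        using r by (intro ennreal_rpow_mono) auto
      also have "\<dots> = ennreal (c * 8 powr (1 / r) * K)"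
        using c K r by (simp add: ennreal_rpow_ennreal powr_mult powr_powr)
      finally show ?thesis using p less_imp_neq[OF p(2)] by (simp add: Lp_norm_def ennreal_rpow_ennreal r_def)
    qed
    then show ?thesis
      unfolding fourier_besov_norm_def
      by (subst Lp_norm_def) (auto intro!: esssup_I)
  qed
  moreover have "0 < c * 8 powr (1 / r)" using c by simp
  ultimately show ?thesis unfolding r_def by blast
qed

section \<open>Sub-Gaussian tails\<close>

definition subgaussian_tail :: "'a measure \<Rightarrow> ('a \<Rightarrow> ennreal) \<Rightarrow> bool" where
  "subgaussian_tail M F \<longleftrightarrow> (\<exists>c>0. \<forall>\<^sub>F K in at_top.
     measure M {\<omega> \<in> space M. F \<omega> > ennreal K} < exp (- c * K\<^sup>2))"

text \<open>
  Replacing \<open>K\<close> by \<open>K / C\<close> turns the rate \<open>c\<close> into \<open>c / C\<^sup>2\<close>. Half of it is enough to absorb the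
  factor \<open>A\<close> for large \<open>K\<close>.
\<close>

lemma (in finite_measure) subgaussian_tailI:
  assumes C: "0 < C" and c: "0 < c" and A: "0 < A"
    and ev: "\<And>K. K0 \<le> K \<Longrightarrow> \<exists>E\<in>sets M. measure M E \<le> A * exp (- c * K\<^sup>2) \<and>
               (\<forall>\<omega>\<in>space M - E. F \<omega> \<le> ennreal (C * K))"
  shows "subgaussian_tail M F"
  unfolding subgaussian_tail_def
proof (intro exI conjI)
  define d where "d = c / (2 * C\<^sup>2)"
  show d: "0 < d" unfolding d_def using C c by simp
  have "filterlim (\<lambda>K::real. d * K\<^sup>2) at_top at_top"
    using d by (intro filterlim_tendsto_pos_mult_at_top[OF tendsto_const] filterlim_pow_at_top filterlim_ident) auto
  then have "\<forall>\<^sub>F K in at_top. ln A < d * K\<^sup>2"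
    by (simp add: filterlim_at_top_dense)
  then show "\<forall>\<^sub>F K in at_top. measure M {\<omega> \<in> space M. F \<omega> > ennreal K} < exp (- d * K\<^sup>2)"
    using eventually_ge_at_top[of "C * K0"]
  proof eventually_elim
    case (elim K)
    define T where "T = {\<omega> \<in> space M. F \<omega> > ennreal K}"
    obtain E where E: "E \<in> sets M" "measure M E \<le> A * exp (- c * (K / C)\<^sup>2)"
      "\<And>\<omega>. \<omega> \<in> space M - E \<Longrightarrow> F \<omega> \<le> ennreal (C * (K / C))"
      using ev[of "K / C"] elim C by (auto simp: field_simps)
    have "T \<subseteq> E"
      using E(3) C unfolding T_def by (auto simp: not_le[symmetric])
    \<comment> \<open>A set that is not measurable has measure 0 by convention.\<close>
    then have "measure M T \<le> measure M E"
      using E(1) finite_measure_mono[of T E] measure_notin_sets[of T M] by (cases "T \<in> sets M") auto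
    also have "\<dots> \<le> exp (ln A) * exp (- c * (K / C)\<^sup>2)" using E(2) A by simp
    also have "\<dots> = exp (ln A - 2 * (d * K\<^sup>2))"
      using C by (simp add: d_def power_divide flip: exp_add)
    also have "\<dots> < exp (- d * K\<^sup>2)"
      using elim by simp
    finally show ?case unfolding T_def .
  qed
qed

section \<open>Exponential moments of complex Gaussians\<close>

text \<open>
  Multiplication by \<open>exp (x\<^sup>2 / 4)\<close> turns the standard normal density into \<open>sqrt 2\<close> times the normal
  density of variance \<open>2\<close>.
\<close>

lemma nn_integral_exp_square_std_normal:
  assumes "distributed M lborel X (\<lambda>x. ennreal (std_normal_density x))"
  shows "(\<integral>\<^sup>+\<omega>. ennreal (exp ((X \<omega>)\<^sup>2 / 4)) \<partial>M) = ennreal (sqrt 2)"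
proof -
  have eq: "std_normal_density x * exp (x\<^sup>2 / 4) = sqrt 2 * normal_density 0 (sqrt 2) x" for x :: real
    by (simp add: normal_density_def real_sqrt_mult field_simps flip: exp_add)
  have "(\<integral>\<^sup>+\<omega>. ennreal (exp ((X \<omega>)\<^sup>2 / 4)) \<partial>M)
      = (\<integral>\<^sup>+x. ennreal (std_normal_density x) * ennreal (exp (x\<^sup>2 / 4)) \<partial>lborel)"
    by (rule distributed_nn_integral[OF assms, symmetric]) simp
  also have "\<dots> = (\<integral>\<^sup>+x. ennreal (sqrt 2) * ennreal (normal_density 0 (sqrt 2) x) \<partial>lborel)"
    by (simp add: eq flip: ennreal_mult)
  also have "\<dots> = ennreal (sqrt 2) * (\<integral>\<^sup>+x. ennreal (normal_density 0 (sqrt 2) x) \<partial>lborel)"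
    by (simp add: nn_integral_cmult)
  also have "(\<integral>\<^sup>+x. ennreal (normal_density 0 (sqrt 2) x) \<partial>lborel) = 1"
    by (subst nn_integral_eq_integral) auto
  finally show ?thesis by simp
qed

lemma (in prob_space) std_complex_gaussian_measurable:
  "std_complex_gaussian X \<Longrightarrow> X \<in> borel_measurable M"
  unfolding std_complex_gaussian_def borel_measurable_complex_iff
  by (auto dest: distributed_measurable)

text \<open>
  As \<open>|X|\<^sup>2 = (Re X)\<^sup>2 + (Im X)\<^sup>2\<close>, the exponential is a product \<open>u v\<close>. The inequality
  \<open>u v \<le> u\<^sup>2 + v\<^sup>2\<close> reduces its integral to the marginal laws and doubles the exponents from
  \<open>1/8\<close> to \<open>1/4\<close>.
\<close>

lemma (in prob_space) std_complex_gaussian_exp_moment: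
  assumes X: "std_complex_gaussian X"
  shows "integrable M (\<lambda>\<omega>. exp ((norm (X \<omega>))\<^sup>2 / 8))"
    and "expectation (\<lambda>\<omega>. exp ((norm (X \<omega>))\<^sup>2 / 8)) \<le> 3"
proof -
  have [measurable]: "X \<in> borel_measurable M" using X by (rule std_complex_gaussian_measurable)
  have le: "exp ((norm (X \<omega>))\<^sup>2 / 8) \<le> exp ((Re (X \<omega>))\<^sup>2 / 4) + exp ((Im (X \<omega>))\<^sup>2 / 4)" for \<omega>
  proof -
    define u v where "u = exp ((Re (X \<omega>))\<^sup>2 / 8)" and "v = exp ((Im (X \<omega>))\<^sup>2 / 8)"
    have "exp ((norm (X \<omega>))\<^sup>2 / 8) = u * v"
      by (simp add: u_def v_def cmod_power2 add_divide_distrib flip: exp_add)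
    also have "\<dots> \<le> u\<^sup>2 + v\<^sup>2"
    proof -
      have "0 \<le> u * v" by (simp add: u_def v_def)
      then show ?thesis using sum_squares_bound[of u v] by linarith
    qed
    also have "u\<^sup>2 + v\<^sup>2 = exp ((Re (X \<omega>))\<^sup>2 / 4) + exp ((Im (X \<omega>))\<^sup>2 / 4)"
      by (simp add: u_def v_def flip: exp_double)
    finally show ?thesis .
  qed
  have "(\<integral>\<^sup>+\<omega>. ennreal (exp ((norm (X \<omega>))\<^sup>2 / 8)) \<partial>M)
      \<le> (\<integral>\<^sup>+\<omega>. ennreal (exp ((Re (X \<omega>))\<^sup>2 / 4)) + ennreal (exp ((Im (X \<omega>))\<^sup>2 / 4)) \<partial>M)"
    using le by (intro nn_integral_mono) (simp add: ennreal_leI flip: ennreal_plus)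
  also have "\<dots> = ennreal (sqrt 2) + ennreal (sqrt 2)"
    using X unfolding std_complex_gaussian_def
    by (simp add: nn_integral_add nn_integral_exp_square_std_normal)
  also have "\<dots> = ennreal (2 * sqrt 2)" by (simp flip: ennreal_plus)
  also have "\<dots> \<le> ennreal 3"
    by (rule ennreal_leI, rule power2_le_imp_le) (auto simp: power_mult_distrib)
  finally have *: "(\<integral>\<^sup>+\<omega>. ennreal (exp ((norm (X \<omega>))\<^sup>2 / 8)) \<partial>M) \<le> ennreal 3" .
  show int: "integrable M (\<lambda>\<omega>. exp ((norm (X \<omega>))\<^sup>2 / 8))"
    using * by (intro integrableI_nonneg) (auto intro: order_le_less_trans)
  show "expectation (\<lambda>\<omega>. exp ((norm (X \<omega>))\<^sup>2 / 8)) \<le> 3"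
  proof -
    have "ennreal (expectation (\<lambda>\<omega>. exp ((norm (X \<omega>))\<^sup>2 / 8))) \<le> ennreal 3"
      using * by (subst nn_integral_eq_integral[OF int, symmetric]) auto
    then show ?thesis by (subst (asm) ennreal_le_iff) auto
  qed
qed

lemma (in prob_space) std_complex_gaussian_tail:
  assumes X: "std_complex_gaussian X"
  shows "prob {\<omega> \<in> space M. t \<le> (norm (X \<omega>))\<^sup>2} \<le> 3 * exp (- t / 8)"
proof -
  note [measurable] = std_complex_gaussian_measurable[OF X]
  have "prob {\<omega> \<in> space M. t \<le> (norm (X \<omega>))\<^sup>2}
      = prob {\<omega> \<in> space M. exp (t / 8) \<le> exp ((norm (X \<omega>))\<^sup>2 / 8)}"
    by simp
  also have "\<dots> \<le> expectation (\<lambda>\<omega>. exp ((norm (X \<omega>))\<^sup>2 / 8)) / exp (t / 8)"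
    by (intro integral_Markov_inequality_measure[where A = "{}"])
       (use std_complex_gaussian_exp_moment(1)[OF X] in auto)
  also have "\<dots> \<le> 3 / exp (t / 8)"
    using std_complex_gaussian_exp_moment(2)[OF X] by (intro divide_right_mono) auto
  finally show ?thesis by (simp add: exp_minus field_simps)
qed

text \<open>
  This is \<open>ln x \<le> x - 1\<close> at \<open>x = y / (8 r)\<close>.
\<close>

lemma powr_le_exp:
  fixes r y :: real
  assumes "0 < r" "0 \<le> y"
  shows "y powr r \<le> (8 * r) powr r * exp (y / 8)"
proof (cases "y = 0")
  case False
  then have y: "0 < y" using assms by simp
  have "ln (y / (8 * r)) \<le> y / (8 * r) - 1"
    using y assms by (intro ln_le_minus_one) auto
  then have "r * ln y \<le> r * (ln (8 * r) + y / (8 * r))"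
    using y assms by (intro mult_left_mono) (auto simp: ln_div)
  also have "\<dots> = r * ln (8 * r) + y / 8" using assms by (simp add: distrib_left)
  finally have "exp (r * ln y) \<le> exp (r * ln (8 * r) + y / 8)" by simp
  then show ?thesis using y assms by (simp add: powr_def exp_add)
qed simp

text \<open>
  The bound depends on \<open>r\<close> only, hence it is uniform over a family of Gaussians.
\<close>

lemma (in prob_space) std_complex_gaussian_moment:
  assumes X: "std_complex_gaussian X" and r: "0 < r"
  shows "integrable M (\<lambda>\<omega>. (norm (X \<omega>) powr r)\<^sup>2)"
    and "expectation (\<lambda>\<omega>. (norm (X \<omega>) powr r)\<^sup>2) \<le> 3 * (8 * r) powr r"
proof -
  note [measurable] = std_complex_gaussian_measurable[OF X]
  have le: "(norm (X \<omega>) powr r)\<^sup>2 \<le> (8 * r) powr r * exp ((norm (X \<omega>))\<^sup>2 / 8)" for \<omega>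
  proof -
    have "(norm (X \<omega>) powr r)\<^sup>2 = ((norm (X \<omega>))\<^sup>2) powr r"
      by (simp add: power2_eq_square powr_mult)
    then show ?thesis using powr_le_exp[OF r, of "(norm (X \<omega>))\<^sup>2"] by simp
  qed
  have int: "integrable M (\<lambda>\<omega>. (8 * r) powr r * exp ((norm (X \<omega>))\<^sup>2 / 8))"
    using std_complex_gaussian_exp_moment(1)[OF X] by simp
  show int2: "integrable M (\<lambda>\<omega>. (norm (X \<omega>) powr r)\<^sup>2)"
    by (rule Bochner_Integration.integrable_bound[OF int]) (use le in auto)
  have "expectation (\<lambda>\<omega>. (norm (X \<omega>) powr r)\<^sup>2)
      \<le> expectation (\<lambda>\<omega>. (8 * r) powr r * exp ((norm (X \<omega>))\<^sup>2 / 8))"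
    by (rule integral_mono[OF int2 int le])
  also have "\<dots> = (8 * r) powr r * expectation (\<lambda>\<omega>. exp ((norm (X \<omega>))\<^sup>2 / 8))" by simp
  also have "\<dots> \<le> (8 * r) powr r * 3"
    using std_complex_gaussian_exp_moment(2)[OF X] by (intro mult_left_mono) auto
  finally show "expectation (\<lambda>\<omega>. (norm (X \<omega>) powr r)\<^sup>2) \<le> 3 * (8 * r) powr r" by simp
qed

section \<open>Growth of the Brownian coefficients\<close>

text \<open>
  Raising the threshold by \<open>16 ln \<langle>n\<rangle>\<close> multiplies the tail probability at \<open>n\<close> by \<open>\<langle>n\<rangle>\<^sup>-\<^sup>2\<close>, which
  makes the union bound over all frequencies converge.
\<close>

lemma (in prob_space) gaussian_family_growth:
  assumes g: "\<And>n. n \<noteq> 0 \<Longrightarrow> std_complex_gaussian (g n)"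
  shows "\<exists>A>0. \<forall>K. \<exists>E\<in>events. prob E \<le> A * exp (- K\<^sup>2 / 8) \<and>
      (\<forall>\<omega>\<in>space M - E. \<forall>n. n \<noteq> 0 \<longrightarrow> (norm (g n \<omega>))\<^sup>2 \<le> K\<^sup>2 + 16 * ln (bracket n))"
proof -
  define w where "w i = bracket (int_decode i) powr (-2)" for i
  have "(\<Sum>i. ennreal (w i)) = (\<integral>\<^sup>+n. ennreal (bracket n powr (-2)) \<partial>count_space UNIV)"
    unfolding w_def nn_integral_count_space_nat[symmetric]
    by (rule nn_integral_bij_count_space[where f = "\<lambda>n. ennreal (bracket n powr (-2))"]) (rule bij_int_decode)
  then have "(\<Sum>i. ennreal (w i)) \<noteq> top"
    using nn_integral_bracket_powr_finite[of "-2"] by simp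
  then have w: "summable w" by (intro summable_suminf_not_top) (auto simp: w_def)
  show ?thesis
  proof (intro exI[of _ "3 * suminf w + 1"] conjI allI)
    show "0 < 3 * suminf w + 1"
      using suminf_nonneg[OF w] by (simp add: w_def)
    fix K :: real
    define T where "T n = (if n = 0 then {} else
        {\<omega> \<in> space M. K\<^sup>2 + 16 * ln (bracket n) \<le> (norm (g n \<omega>))\<^sup>2})" for n
    have T [measurable]: "T n \<in> events" for n
    proof (cases "n = 0")
      case False
      note [measurable] = std_complex_gaussian_measurable[OF g[OF False]]
      show ?thesis using False unfolding T_def by simp
    qed (simp add: T_def)
    have le: "prob (T (int_decode i)) \<le> 3 * exp (- K\<^sup>2 / 8) * w i" for i
    proof (cases "int_decode i = 0")
      case False
      have "prob (T (int_decode i)) \<le> 3 * exp (- (K\<^sup>2 + 16 * ln (bracket (int_decode i))) / 8)"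
        using std_complex_gaussian_tail[OF g[OF False], of "K\<^sup>2 + 16 * ln (bracket (int_decode i))"] False by (simp add: T_def)
      also have "\<dots> = 3 * exp (- K\<^sup>2 / 8) * w i"
        by (simp add: w_def powr_def add_divide_distrib diff_divide_distrib flip: exp_add)
      finally show ?thesis .
    qed (simp add: T_def w_def)
    have sm: "summable (\<lambda>i. prob (T (int_decode i)))"
      by (rule summable_comparison_test'[OF summable_mult[OF w, of "3 * exp (- K\<^sup>2 / 8)"], of 0])
         (use le in auto)
    have "prob (\<Union>i. T (int_decode i)) \<le> (\<Sum>i. prob (T (int_decode i)))"
      using sm by (intro finite_measure_subadditive_countably) auto
    also have "\<dots> \<le> (\<Sum>i. 3 * exp (- K\<^sup>2 / 8) * w i)"
      by (intro suminf_le le sm summable_mult w)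
    also have "\<dots> = 3 * suminf w * exp (- K\<^sup>2 / 8)"
      using w by (simp add: suminf_mult)
    also have "\<dots> \<le> (3 * suminf w + 1) * exp (- K\<^sup>2 / 8)" by simp
    finally have "prob (\<Union>i. T (int_decode i)) \<le> (3 * suminf w + 1) * exp (- K\<^sup>2 / 8)" .
    moreover have "(norm (g n \<omega>))\<^sup>2 \<le> K\<^sup>2 + 16 * ln (bracket n)"
      if "\<omega> \<in> space M - (\<Union>i. T (int_decode i))" "n \<noteq> 0" for \<omega> n
    proof -
      have "\<omega> \<notin> T n" using that(1) int_encode_inverse[of n] by (metis DiffD2 UN_I UNIV_I)
      then show ?thesis using that unfolding T_def by auto
    qed
    ultimately show "\<exists>E\<in>events. prob E \<le> (3 * suminf w + 1) * exp (- K\<^sup>2 / 8) \<and>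
      (\<forall>\<omega>\<in>space M - E. \<forall>n. n \<noteq> 0 \<longrightarrow> (norm (g n \<omega>))\<^sup>2 \<le> K\<^sup>2 + 16 * ln (bracket n))"
      by (intro bexI[of _ "\<Union>i. T (int_decode i)"]) auto
  qed
qed

text \<open>
  The bound \<open>ln b \<le> b\<^bsup>2\<epsilon>\<^esup> / (2 \<epsilon>)\<close> trades the logarithm for a small power, and \<open>K \<ge> 1\<close> allows
  \<open>K\<^sup>2\<close> to be factored out. Dividing by \<open>n\<close> costs one power of the bracket and a factor \<open>sqrt 2\<close>.
\<close>

lemma brownian_coeffs_growth:
  assumes \<epsilon>: "0 < \<epsilon>" and K: "1 \<le> K"
    and gn: "n \<noteq> 0 \<Longrightarrow> (norm (g n \<omega>))\<^sup>2 \<le> K\<^sup>2 + 16 * ln (bracket n)"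
  shows "norm (brownian_coeffs g \<omega> n) \<le> sqrt (2 + 16 / \<epsilon>) * K * bracket n powr (\<epsilon> - 1)"
proof (cases "n = 0")
  case False
  define b where "b = bracket n"
  have b: "1 \<le> b" unfolding b_def by (rule bracket_ge_1)
  have n: "1 \<le> \<bar>real_of_int n\<bar>" using False by linarith
  have b2: "b powr (2 * \<epsilon>) = (b powr \<epsilon>)\<^sup>2"
    by (simp add: power2_eq_square flip: powr_add)
  have "(norm (g n \<omega>))\<^sup>2 \<le> K\<^sup>2 + 16 * ln b" using gn[OF False] by (simp add: b_def)
  also have "\<dots> \<le> K\<^sup>2 * 1 + K\<^sup>2 * (16 * ln b)"
    using K b mult_right_mono[of 1 "K\<^sup>2" "16 * ln b"] by simp
  also have "\<dots> \<le> K\<^sup>2 * b powr (2 * \<epsilon>) + K\<^sup>2 * (16 * (b powr (2 * \<epsilon>) / (2 * \<epsilon>)))"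
    using b \<epsilon> by (intro add_mono mult_left_mono ln_powr_bound ge_one_powr_ge_zero) auto
  also have "\<dots> = (sqrt (1 + 8 / \<epsilon>) * K * b powr \<epsilon>)\<^sup>2"
    unfolding b2 using \<epsilon> by (simp add: power_mult_distrib field_simps)
  finally have "norm (g n \<omega>) \<le> sqrt (1 + 8 / \<epsilon>) * K * b powr \<epsilon>"
    by (rule power2_le_imp_le) (use K \<epsilon> in auto)
  moreover have "1 / \<bar>real_of_int n\<bar> \<le> sqrt 2 / b"
    using bracket_le_sqrt2_abs[OF False] b n by (simp add: b_def field_simps)
  ultimately have "norm (g n \<omega>) * (1 / \<bar>real_of_int n\<bar>)
      \<le> (sqrt (1 + 8 / \<epsilon>) * K * b powr \<epsilon>) * (sqrt 2 / b)"
    using K \<epsilon> by (intro mult_mono) (auto intro!: mult_nonneg_nonneg)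
  also have "\<dots> = (sqrt (1 + 8 / \<epsilon>) * sqrt 2) * K * b powr (\<epsilon> - 1)"
    using b by (simp add: powr_diff)
  also have "sqrt (1 + 8 / \<epsilon>) * sqrt 2 = sqrt (2 + 16 / \<epsilon>)"
    by (simp add: algebra_simps flip: real_sqrt_mult)
  finally show ?thesis using False by (simp add: brownian_coeffs_def norm_divide b_def)
qed (use K \<epsilon> in \<open>simp add: brownian_coeffs_def\<close>)

section \<open>Averages of independent Gaussians over dyadic blocks\<close>

text \<open>
  Chebyshev's inequality. Independence is used through pairs: the mixed products of the centred
  variables have mean zero, so that only the diagonal of the squared sum contributes.
\<close>

lemma (in prob_space) prob_sum_deviation_le:
  fixes X :: "'i \<Rightarrow> 'a \<Rightarrow> real"
  assumes I: "finite I" and ind: "indep_vars (\<lambda>_. borel) X I"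
    and sq: "\<And>i. i \<in> I \<Longrightarrow> integrable M (\<lambda>\<omega>. (X i \<omega>)\<^sup>2)"
    and V: "\<And>i. i \<in> I \<Longrightarrow> expectation (\<lambda>\<omega>. (X i \<omega>)\<^sup>2) \<le> V"
    and t: "0 < t"
  shows "prob {\<omega> \<in> space M. t \<le> \<bar>(\<Sum>i\<in>I. X i \<omega>) - (\<Sum>i\<in>I. expectation (X i))\<bar>}
      \<le> real (card I) * V / t\<^sup>2"
proof -
  have [measurable]: "X i \<in> borel_measurable M" if "i \<in> I" for i
    using ind that unfolding indep_vars_def by auto
  have int: "integrable M (X i)" if "i \<in> I" for i
    by (rule square_integrable_imp_integrable) (use that sq in auto)
  define Y where "Y i \<omega> = X i \<omega> - expectation (X i)" for i \<omega>
  have intY: "integrable M (Y i)" and EY: "expectation (Y i) = 0" if "i \<in> I" for i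
    using int[OF that] unfolding Y_def by (auto simp: prob_space)
  have Y2: "integrable M (\<lambda>\<omega>. (Y i \<omega>)\<^sup>2)" and EY2: "expectation (\<lambda>\<omega>. (Y i \<omega>)\<^sup>2) \<le> V" if "i \<in> I" for i
  proof -
    show "integrable M (\<lambda>\<omega>. (Y i \<omega>)\<^sup>2)"
      using int[OF that] sq[OF that] by (simp add: Y_def power2_diff)
    have "expectation (\<lambda>\<omega>. (Y i \<omega>)\<^sup>2) = expectation (\<lambda>\<omega>. (X i \<omega>)\<^sup>2) - (expectation (X i))\<^sup>2"
      unfolding Y_def using int[OF that] sq[OF that] by (rule variance_eq)
    then show "expectation (\<lambda>\<omega>. (Y i \<omega>)\<^sup>2) \<le> V"
      using V[OF that] zero_le_power2[of "expectation (X i)"] by linarith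
  qed
  have indY: "indep_vars (\<lambda>_. borel) Y I"
    unfolding Y_def by (rule indep_vars_compose2[OF ind]) simp
  have off: "integrable M (\<lambda>\<omega>. Y i \<omega> * Y j \<omega>)" "expectation (\<lambda>\<omega>. Y i \<omega> * Y j \<omega>) = 0"
    if "i \<in> I" "j \<in> I" "i \<noteq> j" for i j
  proof -
    have ij: "indep_vars (\<lambda>_. borel) Y {i, j}" using that by (intro indep_vars_subset[OF indY]) auto
    show "integrable M (\<lambda>\<omega>. Y i \<omega> * Y j \<omega>)"
      using indep_vars_integrable[OF _ ij] that intY by auto
    show "expectation (\<lambda>\<omega>. Y i \<omega> * Y j \<omega>) = 0"
      using indep_vars_lebesgue_integral[OF _ ij] that intY EY by auto
  qed
  have intYY: "integrable M (\<lambda>\<omega>. Y i \<omega> * Y j \<omega>)" if "i \<in> I" "j \<in> I" for i j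
    using off(1)[OF that] Y2[OF that(1)] by (cases "i = j") (auto simp: power2_eq_square)
  have S2: "(\<Sum>i\<in>I. Y i \<omega>)\<^sup>2 = (\<Sum>i\<in>I. \<Sum>j\<in>I. Y i \<omega> * Y j \<omega>)" for \<omega>
    by (simp add: power2_eq_square sum_product)
  have intS: "integrable M (\<lambda>\<omega>. (\<Sum>i\<in>I. Y i \<omega>)\<^sup>2)"
    unfolding S2 by (intro Bochner_Integration.integrable_sum intYY)
  have "expectation (\<lambda>\<omega>. (\<Sum>i\<in>I. Y i \<omega>)\<^sup>2) = (\<Sum>i\<in>I. \<Sum>j\<in>I. expectation (\<lambda>\<omega>. Y i \<omega> * Y j \<omega>))"
    unfolding S2 by (simp add: Bochner_Integration.integral_sum Bochner_Integration.integrable_sum intYY)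
  also have "\<dots> = (\<Sum>i\<in>I. \<Sum>j\<in>I. if i = j then expectation (\<lambda>\<omega>. (Y i \<omega>)\<^sup>2) else 0)"
    by (intro sum.cong refl) (auto simp: off power2_eq_square)
  also have "\<dots> = (\<Sum>i\<in>I. expectation (\<lambda>\<omega>. (Y i \<omega>)\<^sup>2))"
    using I by (simp add: sum.delta)
  also have "\<dots> \<le> real (card I) * V"
    using sum_bounded_above[of I _ V] EY2 by simp
  finally have var: "expectation (\<lambda>\<omega>. (\<Sum>i\<in>I. Y i \<omega>)\<^sup>2) \<le> real (card I) * V" .
  have "prob {\<omega> \<in> space M. t \<le> \<bar>\<Sum>i\<in>I. Y i \<omega>\<bar>} \<le> expectation (\<lambda>\<omega>. (\<Sum>i\<in>I. Y i \<omega>)\<^sup>2) / t\<^sup>2"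
    using intS t by (intro second_moment_method) (auto simp: Y_def)
  also have "\<dots> \<le> real (card I) * V / t\<^sup>2" using var by (intro divide_right_mono) auto
  finally show ?thesis by (simp add: Y_def sum_subtractf)
qed

text \<open>
  If \<open>Pr \<le> x\<close> and \<open>Pr \<le> y\<close>, then \<open>Pr \<le> x\<^bsup>1/3\<^esup> y\<^bsup>2/3\<^esup>\<close>. Here \<open>x \<sim> 2\<^sup>j exp (- K\<^sup>2 / 8)\<close> is
  the union bound, as one of the Gaussians has to exceed \<open>K\<close> for the average to be too
  large, and \<open>y \<sim> 2\<^sup>-\<^sup>j\<close> is the Chebyshev bound. Any positive weights that favour
  \<open>y\<close> would serve.
  The constant \<open>V\<close> bounds the second moments of \<open>|g n|\<^sup>r\<close>, and \<open>1 + V\<close> their means.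
\<close>

lemma (in prob_space) dyadic_average_tail:
  assumes ind: "indep_vars (\<lambda>_. borel) g (- {0})"
    and g: "\<And>n. n \<noteq> 0 \<Longrightarrow> std_complex_gaussian (g n)"
    and r: "0 < r" and V: "3 * (8 * r) powr r \<le> V" and K: "0 \<le> K" "V + 2 \<le> K powr r"
  shows "prob {\<omega> \<in> space M. 4 * 2 ^ j * K powr r < (\<Sum>n\<in>low_freqs j. norm (g n \<omega>) powr r)}
      \<le> 3 * (V + 1) * exp (- K\<^sup>2 / 24) * (2 powr (- 1 / 3)) ^ j" (is "prob ?T \<le> _")
proof -
  have V0: "0 \<le> V" using V by (rule order_trans[rotated]) simp
  have [measurable]: "g n \<in> borel_measurable M" if "n \<in> low_freqs j" for n
    using that by (intro std_complex_gaussian_measurable g) (auto simp: low_freqs_def)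
  have T: "?T \<in> events" by measurable
  have union: "prob ?T \<le> 12 * 2 ^ j * exp (- K\<^sup>2 / 8)"
  proof -
    have "?T \<subseteq> (\<Union>n\<in>low_freqs j. {\<omega> \<in> space M. K\<^sup>2 \<le> (norm (g n \<omega>))\<^sup>2})"
    proof (rule subsetI, rule ccontr)
      fix \<omega> assume \<omega>: "\<omega> \<in> ?T"
        and "\<omega> \<notin> (\<Union>n\<in>low_freqs j. {\<omega> \<in> space M. K\<^sup>2 \<le> (norm (g n \<omega>))\<^sup>2})"
      then have "(norm (g n \<omega>))\<^sup>2 \<le> K\<^sup>2" if "n \<in> low_freqs j" for n
        using that by (force simp: not_le)
      then have "norm (g n \<omega>) powr r \<le> K powr r" if "n \<in> low_freqs j" for n
        using that K(1) r by (intro powr_mono2) (auto intro: power2_le_imp_le)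
      then have "(\<Sum>n\<in>low_freqs j. norm (g n \<omega>) powr r) \<le> real (card (low_freqs j)) * K powr r"
        using sum_bounded_above[of "low_freqs j" "\<lambda>n. norm (g n \<omega>) powr r" "K powr r"] by simp
      then show False using \<omega> by (simp add: card_low_freqs)
    qed
    then have "prob ?T \<le> prob (\<Union>n\<in>low_freqs j. {\<omega> \<in> space M. K\<^sup>2 \<le> (norm (g n \<omega>))\<^sup>2})"
      by (intro finite_measure_mono) auto
    also have "\<dots> \<le> (\<Sum>n\<in>low_freqs j. prob {\<omega> \<in> space M. K\<^sup>2 \<le> (norm (g n \<omega>))\<^sup>2})"
      by (intro measure_UNION_le) auto
    also have "\<dots> \<le> real (card (low_freqs j)) * (3 * exp (- K\<^sup>2 / 8))"
      using g std_complex_gaussian_tail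
      by (intro sum_bounded_above) (auto simp: low_freqs_def)
    finally show ?thesis by (simp add: card_low_freqs)
  qed
  have cheb: "prob ?T \<le> V / 2 ^ j"
  proof -
    define X where "X n \<omega> = norm (g n \<omega>) powr r" for n \<omega>
    have sq: "integrable M (\<lambda>\<omega>. (X n \<omega>)\<^sup>2)" "expectation (\<lambda>\<omega>. (X n \<omega>)\<^sup>2) \<le> V"
      if "n \<in> low_freqs j" for n
      using std_complex_gaussian_moment[OF g r] that V by (force simp: X_def low_freqs_def)+
    have indX: "indep_vars (\<lambda>_. borel) X (low_freqs j)"
    proof -
      have "indep_vars (\<lambda>_. borel) g (low_freqs j)"
        by (rule indep_vars_subset[OF ind]) (auto simp: low_freqs_def)
      then show ?thesis unfolding X_def
        by (rule indep_vars_compose2[where Y = "\<lambda>_ z. norm z powr r"]) simp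
    qed
    have [measurable]: "X n \<in> borel_measurable M" if "n \<in> low_freqs j" for n
      using that unfolding X_def by measurable
    have mean: "expectation (X n) \<le> 1 + V" if "n \<in> low_freqs j" for n
    proof -
      have "expectation (X n) \<le> expectation (\<lambda>\<omega>. 1 + (X n \<omega>)\<^sup>2)"
      proof (rule integral_mono)
        show "integrable M (X n)"
          by (rule square_integrable_imp_integrable) (use that sq in auto)
        show "X n \<omega> \<le> 1 + (X n \<omega>)\<^sup>2" for \<omega>
        proof -
          have "0 \<le> X n \<omega>" by (simp add: X_def)
          then show ?thesis using zero_le_power2[of "X n \<omega> - 1"] by (simp add: power2_diff)
        qed
      qed (use sq that in auto)
      also have "\<dots> \<le> 1 + V" using sq[OF that] by (simp add: prob_space)
      finally show ?thesis .
    qed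
    have "(\<Sum>n\<in>low_freqs j. expectation (X n)) \<le> real (card (low_freqs j)) * (1 + V)"
      using mean by (intro sum_bounded_above) auto
    also have "\<dots> \<le> 4 * 2 ^ j * K powr r - 4 * 2 ^ j"
    proof -
      \<comment> \<open>The means are at most \<open>K powr r - 1\<close>; the gap 1 is what Chebyshev needs.\<close>
      have "4 * 2 ^ j * (1 + V) \<le> 4 * 2 ^ j * (K powr r - 1)"
        using K(2) by (intro mult_left_mono) auto
      then show ?thesis by (simp add: card_low_freqs algebra_simps)
    qed
    finally have "?T \<subseteq> {\<omega> \<in> space M. 4 * 2 ^ j \<le>
        \<bar>(\<Sum>n\<in>low_freqs j. X n \<omega>) - (\<Sum>n\<in>low_freqs j. expectation (X n))\<bar>}"
      by (auto simp: X_def)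
    then have "prob ?T \<le> prob {\<omega> \<in> space M. 4 * 2 ^ j \<le>
        \<bar>(\<Sum>n\<in>low_freqs j. X n \<omega>) - (\<Sum>n\<in>low_freqs j. expectation (X n))\<bar>}"
      by (intro finite_measure_mono) auto
    also have "\<dots> \<le> real (card (low_freqs j)) * V / (4 * 2 ^ j)\<^sup>2"
      by (rule prob_sum_deviation_le[OF _ indX]) (use sq in auto)
    also have "\<dots> \<le> V / 2 ^ j"
      using V0 by (simp add: card_low_freqs power2_eq_square field_simps)
    finally show ?thesis .
  qed
  have "prob ?T = prob ?T powr (1 / 3) * prob ?T powr (2 / 3)"
    by (simp flip: powr_add)
  also have "\<dots> \<le> (12 * 2 ^ j * exp (- K\<^sup>2 / 8)) powr (1 / 3) * (V / 2 ^ j) powr (2 / 3)"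
    using union cheb by (intro mult_mono powr_mono2) auto
  also have "\<dots> = 12 powr (1 / 3) * V powr (2 / 3) * exp (- K\<^sup>2 / 24)
      * ((2 ^ j) powr (1 / 3) / (2 ^ j) powr (2 / 3))"
    using V0 by (simp add: powr_mult powr_divide exp_powr_real)
  also have "(2 ^ j) powr (1 / 3) / (2 ^ j) powr (2 / 3) = (2 powr (- 1 / 3) :: real) ^ j"
  proof -
    have "(2 ^ j) powr (1 / 3) / (2 ^ j) powr (2 / 3) = (2 ^ j :: real) powr (- 1 / 3)"
      by (simp flip: powr_diff)
    also have "\<dots> = (2 powr real j) powr (- 1 / 3)" by (simp add: powr_realpow)
    also have "\<dots> = (2 powr (- 1 / 3)) powr real j" by (simp add: powr_powr mult.commute)
    finally show ?thesis by (simp add: powr_realpow)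
  qed
  also have "12 powr (1 / 3) * V powr (2 / 3) * exp (- K\<^sup>2 / 24) * (2 powr (- 1 / 3)) ^ j
      \<le> 3 * (V + 1) * exp (- K\<^sup>2 / 24) * (2 powr (- 1 / 3)) ^ j"
  proof (intro mult_right_mono mult_mono)
    have "(12::real) powr (1 / 3) \<le> (3 ^ 3) powr (1 / 3)" by (intro powr_mono2) auto
    also have "\<dots> = (3 powr 3) powr (1 / 3)" by (simp add: powr_numeral)
    also have "\<dots> = 3" by (subst powr_powr) simp
    finally show "(12::real) powr (1 / 3) \<le> 3" .
    have "V powr (2 / 3) \<le> (V + 1) powr (2 / 3)" using V0 by (intro powr_mono2) auto
    also have "\<dots> \<le> (V + 1) powr 1" using V0 by (intro powr_mono) auto
    finally show "V powr (2 / 3) \<le> V + 1" using V0 by simp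
  qed (use V0 in auto)
  finally show ?thesis .
qed

lemma (in prob_space) dyadic_averages_bound:
  assumes ind: "indep_vars (\<lambda>_. borel) g (- {0})"
    and g: "\<And>n. n \<noteq> 0 \<Longrightarrow> std_complex_gaussian (g n)"
    and r: "1 \<le> r"
  shows "\<exists>A>0. \<exists>K0>0. \<forall>K\<ge>K0. \<exists>E\<in>events. prob E \<le> A * exp (- K\<^sup>2 / 24) \<and>
      (\<forall>\<omega>\<in>space M - E. \<forall>j. (\<Sum>n\<in>low_freqs j. norm (g n \<omega>) powr r) \<le> 4 * 2 ^ j * K powr r)"
proof -
  define V where "V = 3 * (8 * r) powr r"
  define \<beta> :: real where "\<beta> = 2 powr (- 1 / 3)"
  have V: "0 \<le> V" by (simp add: V_def)
  have \<beta>: "0 < \<beta>" "\<beta> < 1" unfolding \<beta>_def using powr_less_mono[of "- 1 / 3" 0 "2::real"] by auto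
  define A where "A = 3 * (V + 1) * (1 / (1 - \<beta>))"
  show ?thesis
  proof (rule exI[of _ A], intro exI[of _ "V + 2"] conjI allI impI)
    show "0 < A" using V \<beta> by (simp add: A_def)
    show "0 < V + 2" using V by simp
    fix K assume K: "V + 2 \<le> K"
    then have K1: "1 \<le> K" using V by simp
    then have Kr: "V + 2 \<le> K powr r" using powr_mono[of 1 r K] r K by simp
    define T where "T j = {\<omega> \<in> space M. 4 * 2 ^ j * K powr r < (\<Sum>n\<in>low_freqs j. norm (g n \<omega>) powr r)}" for j
    have T: "T j \<in> events" for j
    proof -
      have [measurable]: "g n \<in> borel_measurable M" if "n \<in> low_freqs j" for n
        using that by (intro std_complex_gaussian_measurable g) (auto simp: low_freqs_def)
      show ?thesis unfolding T_def by measurable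
    qed
    have le: "prob (T j) \<le> 3 * (V + 1) * exp (- K\<^sup>2 / 24) * \<beta> ^ j" for j
      unfolding T_def \<beta>_def using r K1 Kr
      by (intro dyadic_average_tail[OF ind g]) (auto simp: V_def)
    have geo: "summable (\<lambda>j. \<beta> ^ j)" using \<beta> by (simp add: summable_geometric)
    have sm: "summable (\<lambda>j. prob (T j))"
      by (rule summable_comparison_test'[OF summable_mult[OF geo, of "3 * (V + 1) * exp (- K\<^sup>2 / 24)"], of 0])
         (use le in auto)
    have "prob (\<Union>j. T j) \<le> (\<Sum>j. prob (T j))"
      using T sm by (intro finite_measure_subadditive_countably) auto
    also have "\<dots> \<le> (\<Sum>j. 3 * (V + 1) * exp (- K\<^sup>2 / 24) * \<beta> ^ j)"
      by (intro suminf_le le sm summable_mult geo)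
    also have "\<dots> = A * exp (- K\<^sup>2 / 24)"
      using \<beta> geo by (simp add: suminf_mult suminf_geometric A_def)
    finally have "prob (\<Union>j. T j) \<le> A * exp (- K\<^sup>2 / 24)" .
    moreover have "(\<Sum>n\<in>low_freqs j. norm (g n \<omega>) powr r) \<le> 4 * 2 ^ j * K powr r"
      if "\<omega> \<in> space M - (\<Union>j. T j)" for \<omega> j
    proof -
      have "\<omega> \<in> space M" "\<omega> \<notin> T j" using that by blast+
      then show ?thesis by (simp add: T_def not_less)
    qed
    moreover have "(\<Union>j. T j) \<in> events" using T by (intro sets.countable_UN) auto
    ultimately show "\<exists>E\<in>events. prob E \<le> A * exp (- K\<^sup>2 / 24) \<and>
      (\<forall>\<omega>\<in>space M - E. \<forall>j. (\<Sum>n\<in>low_freqs j. norm (g n \<omega>) powr r) \<le> 4 * 2 ^ j * K powr r)"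
      by blast
  qed
qed

section \<open>Tail bounds for the norms of Brownian motion\<close>

text \<open>
  The common part of the two subcritical cases: \<open>F\<close> stands for a norm that is bounded, up to a
  constant, by the best \<open>B\<close> with \<open>|a(n)| \<le> B \<langle>n\<rangle>\<^bsup>\<epsilon>-1\<^esup>\<close>.
\<close>

lemma (in prob_space) brownian_subgaussian_tail:
  assumes g: "\<And>n. n \<noteq> 0 \<Longrightarrow> std_complex_gaussian (g n)" and \<epsilon>: "0 < \<epsilon>"
    and det: "\<exists>D>0. \<forall>a B. 0 < B \<longrightarrow> (\<forall>n. norm (a n) \<le> B * bracket n powr (\<epsilon> - 1)) \<longrightarrow> F a \<le> ennreal (D * B)"
  shows "subgaussian_tail M (\<lambda>\<omega>. F (brownian_coeffs g \<omega>))"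
proof -
  obtain D where D: "0 < D"
    "\<And>a B. 0 < B \<Longrightarrow> (\<And>n. norm (a n) \<le> B * bracket n powr (\<epsilon> - 1)) \<Longrightarrow> F a \<le> ennreal (D * B)"
    using det by blast
  have "\<exists>A>0. \<forall>K. \<exists>E\<in>events. prob E \<le> A * exp (- K\<^sup>2 / 8) \<and>
      (\<forall>\<omega>\<in>space M - E. \<forall>n. n \<noteq> 0 \<longrightarrow> (norm (g n \<omega>))\<^sup>2 \<le> K\<^sup>2 + 16 * ln (bracket n))"
    by (rule gaussian_family_growth) (rule g)
  then obtain A where A: "0 < A" "\<forall>K. \<exists>E\<in>events. prob E \<le> A * exp (- K\<^sup>2 / 8) \<and>
      (\<forall>\<omega>\<in>space M - E. \<forall>n. n \<noteq> 0 \<longrightarrow> (norm (g n \<omega>))\<^sup>2 \<le> K\<^sup>2 + 16 * ln (bracket n))"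
    by (elim exE conjE)
  define S where "S = sqrt (2 + 16 / \<epsilon>)"
  have S: "0 < S" unfolding S_def using \<epsilon> by (simp add: add_pos_pos)
  show ?thesis
  proof (rule subgaussian_tailI[where C = "D * S" and c = "1 / 8" and A = A and ?K0.0 = 1])
    fix K :: real assume K: "1 \<le> K"
    obtain E where E: "E \<in> events" "prob E \<le> A * exp (- K\<^sup>2 / 8)"
      "\<forall>\<omega>\<in>space M - E. \<forall>n. n \<noteq> 0 \<longrightarrow> (norm (g n \<omega>))\<^sup>2 \<le> K\<^sup>2 + 16 * ln (bracket n)"
      using spec[OF A(2), of K] by (elim bexE conjE)
    have "F (brownian_coeffs g \<omega>) \<le> ennreal (D * (S * K))" if "\<omega> \<in> space M - E" for \<omega>
      unfolding S_def
      using S K by (intro D(2) brownian_coeffs_growth[OF \<epsilon> K] E(3)[rule_format, OF that]) (auto simp: S_def)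
    then show "\<exists>E\<in>events. prob E \<le> A * exp (- (1 / 8) * K\<^sup>2) \<and>
        (\<forall>\<omega>\<in>space M - E. F (brownian_coeffs g \<omega>) \<le> ennreal (D * S * K))"
      using E(1,2) by (intro bexI[of _ E]) (auto simp: mult_ac)
  qed (use D S A in auto)
qed

text \<open>
  The restriction \<open>\<epsilon> \<le> 1 / 2\<close> keeps \<open>2 \<epsilon>\<close> admissible as the growth exponent in \<open>modulation_norm_le\<close>.
\<close>

lemma subcritical_exponent_slack:
  assumes "1 \<le> q" and "if q = \<infinity> then s < 1 else (s - 1) * enn2real q < -1"
  shows "\<exists>\<epsilon>>0. \<epsilon> \<le> 1 / 2 \<and> lp_norm q (\<lambda>n. ennreal (bracket n powr (s - 1 + 2 * \<epsilon>))) < \<infinity>"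
proof (cases "q = \<infinity>")
  case True
  define \<epsilon> where "\<epsilon> = min (1 / 2) ((1 - s) / 2)"
  have "\<epsilon> \<le> (1 - s) / 2" unfolding \<epsilon>_def by (rule min.cobounded2)
  then have "lp_norm q (\<lambda>n. ennreal (bracket n powr (s - 1 + 2 * \<epsilon>))) < \<infinity>"
    using assms(1) True by (intro lp_norm_bracket_finite) auto
  moreover have "0 < \<epsilon>" "\<epsilon> \<le> 1 / 2" using assms True by (auto simp: \<epsilon>_def)
  ultimately show ?thesis by blast
next
  case False
  define r where "r = enn2real q"
  have r: "1 \<le> r" unfolding r_def using assms(1) False by (rule enn2real_ge_1)
  have s: "(s - 1) * r < -1" using assms(2) False by (simp add: r_def)
  \<comment> \<open>With this choice \<open>(s - 1 + 2 \<delta>) r\<close> is the midpoint of \<open>(s - 1) r\<close> and \<open>-1\<close>.\<close>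
  define \<delta> where "\<delta> = (1 - s - 1 / r) / 4"
  define \<epsilon> where "\<epsilon> = min (1 / 2) \<delta>"
  have \<delta>: "0 < \<delta>" using s r by (simp add: \<delta>_def field_simps)
  have "(s - 1 + 2 * \<epsilon>) * r \<le> (s - 1 + 2 * \<delta>) * r"
    using r by (intro mult_right_mono) (auto simp: \<epsilon>_def)
  also have "\<dots> = ((s - 1) * r - 1) / 2" using r by (simp add: \<delta>_def field_simps)
  also have "\<dots> < -1" using s by simp
  finally have "lp_norm q (\<lambda>n. ennreal (bracket n powr (s - 1 + 2 * \<epsilon>))) < \<infinity>"
    using assms False by (intro lp_norm_bracket_finite) (auto simp: r_def)
  moreover have "0 < \<epsilon>" "\<epsilon> \<le> 1 / 2" using \<delta> by (auto simp: \<epsilon>_def)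
  ultimately show ?thesis by blast
qed

lemma (in prob_space) modulation_norm_subgaussian_tail:
  assumes g: "\<And>n. n \<noteq> 0 \<Longrightarrow> std_complex_gaussian (g n)" and "1 \<le> p" "1 \<le> q"
    and "if q = \<infinity> then s < 1 else (s - 1) * enn2real q < - 1"
  shows "subgaussian_tail M (\<lambda>\<omega>. modulation_norm \<psi> s p q (brownian_coeffs g \<omega>))"
proof -
  obtain \<epsilon> where "0 < \<epsilon>" "\<epsilon> \<le> 1 / 2"
    "lp_norm q (\<lambda>n. ennreal (bracket n powr (s - 1 + 2 * \<epsilon>))) < \<infinity>"
    using subcritical_exponent_slack assms(3,4) by blast
  with assms(2,3) show ?thesis
    by (intro brownian_subgaussian_tail[OF g, where \<epsilon> = "2 * \<epsilon>"] modulation_norm_le) auto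
qed

lemma (in prob_space) fourier_besov_norm_subgaussian_tail:
  assumes g: "\<And>n. n \<noteq> 0 \<Longrightarrow> std_complex_gaussian (g n)" and "1 \<le> p" "1 \<le> q"
    and "dyadic_partition \<phi>0 \<phi>"
    and "if p = \<infinity> then s < 1 else (s - 1) * enn2real p < - 1"
  shows "subgaussian_tail M (\<lambda>\<omega>. fourier_besov_norm \<phi>0 \<phi> s p q (brownian_coeffs g \<omega>))"
proof -
  obtain \<epsilon> where "0 < \<epsilon>"
    "lp_norm p (\<lambda>n. ennreal (bracket n powr (s - 1 + 2 * \<epsilon>))) < \<infinity>"
    using subcritical_exponent_slack assms(2,5) by blast
  with assms(2-4) show ?thesis
    by (intro brownian_subgaussian_tail[OF g, where \<epsilon> = \<epsilon>] fourier_besov_norm_le) auto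
qed

lemma (in prob_space) fourier_besov_norm_critical_subgaussian_tail:
  assumes ind: "indep_vars (\<lambda>_. borel) g (- {0})"
    and g: "\<And>n. n \<noteq> 0 \<Longrightarrow> std_complex_gaussian (g n)" and p: "1 \<le> p" "p < \<infinity>"
    and part: "dyadic_partition \<phi>0 \<phi>"
    and crit: "(s - 1) * enn2real p = - 1"
  shows "subgaussian_tail M (\<lambda>\<omega>. fourier_besov_norm \<phi>0 \<phi> s p \<infinity> (brownian_coeffs g \<omega>))"
proof -
  define r where "r = enn2real p"
  have r: "1 \<le> r" unfolding r_def using p by (intro enn2real_ge_1) auto
  obtain D where D: "0 < D" "\<And>a K. 0 < K \<Longrightarrow> a 0 = 0 \<Longrightarrow>
      (\<And>j. (\<Sum>n\<in>low_freqs j. norm (of_int n * a n) powr r) \<le> 4 * 2 ^ j * K powr r)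
      \<Longrightarrow> fourier_besov_norm \<phi>0 \<phi> s p \<infinity> a \<le> ennreal (D * K)"
    using fourier_besov_norm_critical_le[OF p part crit] unfolding r_def by blast
  have "\<exists>A>0. \<exists>K0>0. \<forall>K\<ge>K0. \<exists>E\<in>events. prob E \<le> A * exp (- K\<^sup>2 / 24) \<and>
      (\<forall>\<omega>\<in>space M - E. \<forall>j. (\<Sum>n\<in>low_freqs j. norm (g n \<omega>) powr r) \<le> 4 * 2 ^ j * K powr r)"
    by (rule dyadic_averages_bound[OF ind _ r]) (rule g)
  then obtain A K0 where A: "0 < A" "0 < K0" "\<forall>K\<ge>K0. \<exists>E\<in>events. prob E \<le> A * exp (- K\<^sup>2 / 24) \<and>
      (\<forall>\<omega>\<in>space M - E. \<forall>j. (\<Sum>n\<in>low_freqs j. norm (g n \<omega>) powr r) \<le> 4 * 2 ^ j * K powr r)"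
    by (elim exE conjE)
  show ?thesis
  proof (rule subgaussian_tailI[where C = D and c = "1 / 24" and A = A and ?K0.0 = K0])
    fix K :: real assume K: "K0 \<le> K"
    obtain E where E: "E \<in> events" "prob E \<le> A * exp (- K\<^sup>2 / 24)"
      "\<forall>\<omega>\<in>space M - E. \<forall>j. (\<Sum>n\<in>low_freqs j. norm (g n \<omega>) powr r) \<le> 4 * 2 ^ j * K powr r"
      using mp[OF spec[OF A(3), of K] K] by (elim bexE conjE)
    have "fourier_besov_norm \<phi>0 \<phi> s p \<infinity> (brownian_coeffs g \<omega>) \<le> ennreal (D * K)"
      if "\<omega> \<in> space M - E" for \<omega>
    proof (rule D(2))
      fix j
      have "(\<Sum>n\<in>low_freqs j. norm (of_int n * brownian_coeffs g \<omega> n) powr r)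
          = (\<Sum>n\<in>low_freqs j. norm (g n \<omega>) powr r)"
        by (intro sum.cong) (auto simp: brownian_coeffs_def low_freqs_def)
      then show "(\<Sum>n\<in>low_freqs j. norm (of_int n * brownian_coeffs g \<omega> n) powr r) \<le> 4 * 2 ^ j * K powr r"
        using E(3)[rule_format, OF that, of j] by simp
    qed (use A K in \<open>auto simp: brownian_coeffs_def\<close>)
    then show "\<exists>E\<in>events. prob E \<le> A * exp (- (1 / 24) * K\<^sup>2) \<and>
        (\<forall>\<omega>\<in>space M - E. fourier_besov_norm \<phi>0 \<phi> s p \<infinity> (brownian_coeffs g \<omega>) \<le> ennreal (D * K))"
      using E(1,2) by (intro bexI[of _ E]) auto
  qed (use D A in auto)
qed

text \<open>
  All smaller rates are recorded as well, so that finitely many such bounds can share one rate; the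
  condition \<open>P\<close> is carried along because \<open>c\<close> is chosen before the case distinction.
\<close>

lemma subgaussian_tail_ex_rate:
  assumes "P \<Longrightarrow> subgaussian_tail M F"
  shows "\<exists>c>0. \<forall>d. 0 < d \<and> d \<le> c \<longrightarrow> (\<forall>\<^sub>F K in at_top.
    P \<longrightarrow> measure M {\<omega> \<in> space M. F \<omega> > ennreal K} < exp (- d * K\<^sup>2))"
proof (cases P)
  case True
  then obtain c where c: "0 < c"
    "\<forall>\<^sub>F K in at_top. measure M {\<omega> \<in> space M. F \<omega> > ennreal K} < exp (- c * K\<^sup>2)"
    using assms unfolding subgaussian_tail_def by blast
  have "\<forall>\<^sub>F K in at_top. P \<longrightarrow> measure M {\<omega> \<in> space M. F \<omega> > ennreal K} < exp (- d * K\<^sup>2)"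
    if "d \<le> c" for d
    using c(2)
  proof eventually_elim
    case (elim K)
    have "exp (- c * K\<^sup>2) \<le> exp (- d * K\<^sup>2)" using that by (simp add: mult_right_mono)
    with elim show ?case by linarith
  qed
  then show ?thesis using c(1) by blast
next
  case False
  then show ?thesis by (intro exI[of _ 1]) auto
qed

theorem theorem2p5:
  fixes M :: "'a measure" and g :: "int \<Rightarrow> 'a \<Rightarrow> complex"
    and p q :: ennreal and s :: real
    and \<psi> :: "int \<Rightarrow> complex" and \<phi>0 \<phi> :: "real \<Rightarrow> complex"
  assumes "prob_space M"
    and "prob_space.indep_vars M (\<lambda>_. borel) g (- {0})"
    and "\<And>n. n \<noteq> 0 \<Longrightarrow> prob_space.std_complex_gaussian M (g n)"
    and "1 \<le> p" and "1 \<le> q"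
    and "modulation_window \<psi>"
    and "dyadic_partition \<phi>0 \<phi>"
  shows "\<exists>c>0. \<forall>\<^sub>F K in at_top.
    ((if q = \<infinity> then s < 1 else (s - 1) * enn2real q < - 1) \<longrightarrow>
       measure M {\<omega> \<in> space M. modulation_norm \<psi> s p q (brownian_coeffs g \<omega>) > ennreal K}
         < exp (- c * K\<^sup>2)) \<and>
    ((if p = \<infinity> then s < 1 else (s - 1) * enn2real p < - 1) \<longrightarrow>
       measure M {\<omega> \<in> space M. fourier_besov_norm \<phi>0 \<phi> s p q (brownian_coeffs g \<omega>) > ennreal K}
         < exp (- c * K\<^sup>2)) \<and>
    (p < \<infinity> \<and> (s - 1) * enn2real p = - 1 \<and> q = \<infinity> \<longrightarrow>
       measure M {\<omega> \<in> space M. fourier_besov_norm \<phi>0 \<phi> s p \<infinity> (brownian_coeffs g \<omega>) > ennreal K}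
         < exp (- c * K\<^sup>2))"
proof -
  interpret prob_space M by fact
  let ?F1 = "\<lambda>\<omega>. modulation_norm \<psi> s p q (brownian_coeffs g \<omega>)"
  let ?F2 = "\<lambda>\<omega>. fourier_besov_norm \<phi>0 \<phi> s p q (brownian_coeffs g \<omega>)"
  let ?F3 = "\<lambda>\<omega>. fourier_besov_norm \<phi>0 \<phi> s p \<infinity> (brownian_coeffs g \<omega>)"
  let ?P1 = "if q = \<infinity> then s < 1 else (s - 1) * enn2real q < - 1"
  let ?P2 = "if p = \<infinity> then s < 1 else (s - 1) * enn2real p < - 1"
  let ?P3 = "p < \<infinity> \<and> (s - 1) * enn2real p = - 1 \<and> q = \<infinity>"
  obtain c1 where c1: "0 < c1" "\<And>d. 0 < d \<Longrightarrow> d \<le> c1 \<Longrightarrow> \<forall>\<^sub>F K in at_top.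
      ?P1 \<longrightarrow> prob {\<omega> \<in> space M. ?F1 \<omega> > ennreal K} < exp (- d * K\<^sup>2)"
    using subgaussian_tail_ex_rate[of ?P1 M ?F1, OF modulation_norm_subgaussian_tail[OF assms(3-5)]]
    by blast
  obtain c2 where c2: "0 < c2" "\<And>d. 0 < d \<Longrightarrow> d \<le> c2 \<Longrightarrow> \<forall>\<^sub>F K in at_top.
      ?P2 \<longrightarrow> prob {\<omega> \<in> space M. ?F2 \<omega> > ennreal K} < exp (- d * K\<^sup>2)"
    using subgaussian_tail_ex_rate[of ?P2 M ?F2, OF fourier_besov_norm_subgaussian_tail[OF assms(3-5,7)]]
    by blast
  have "?P3 \<Longrightarrow> subgaussian_tail M ?F3"
    using fourier_besov_norm_critical_subgaussian_tail[OF assms(2-4) _ assms(7)] by blast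
  from subgaussian_tail_ex_rate[OF this]
  obtain c3 where c3: "0 < c3" "\<And>d. 0 < d \<Longrightarrow> d \<le> c3 \<Longrightarrow> \<forall>\<^sub>F K in at_top.
      ?P3 \<longrightarrow> prob {\<omega> \<in> space M. ?F3 \<omega> > ennreal K} < exp (- d * K\<^sup>2)"
    by blast
  define c where "c = min c1 (min c2 c3)"
  have c: "0 < c" "c \<le> c1" "c \<le> c2" "c \<le> c3" using c1(1) c2(1) c3(1) by (auto simp: c_def)
  show ?thesis
    by (intro exI[of _ c] conjI eventually_conj c1(2) c2(2) c3(2) c)
qed

end
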